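(* Let $\mathbb{K}$ be the comonad on simplicial abelian groups associated to the adjunction $\widetilde{\mathbb{Z}}:\mathsf{sSet}_*\rightleftarrows\mathsf{sAb}:\mathbb{U}$. Then the comparison adjunction $\mathrm{Can}_{\mathbb{K}}:\mathsf{sSet}_*\rightleftarrows\mathsf{coAlg}_{\mathbb{K}}:V_{\mathbb{K}}$ is an equivalence of categories.
   Context: $\mathsf{sSet}_*$ is the category of pointed simplicial sets and $\mathsf{sAb}$ the category of simplicial abelian groups. $\widetilde{\mathbb{Z}}(X)=\mathbb{Z}(X)/\mathbb{Z}( * )$ is the (levelwise) reduced free abelian group functor, left adjoint to the forgetful functor $\mathbb{U}$ (basepoint $0$); $\eta:\mathrm{id}\to\mathbb{U}\widetilde{\mathbb{Z}}$ is the unit and $\epsilon:\widetilde{\mathbb{Z}}\mathbb{U}\to\mathrm{id}$ the counit. The associated comonad on $\mathsf{sAb}$ is $\mathbb{K}=(\widetilde{\mathbb{Z}}\mathbb{U},\Delta=\widetilde{\mathbb{Z}}\eta_{\mathbb{U}},\epsilon)$. A $\mathbb{K}$-coalgebra is a pair $(A,\delta)$ with $A\in\mathsf{sAb}$ and $\delta:A\to\widetilde{\mathbb{Z}}\mathbb{U}A$ a morphism in $\mathsf{sAb}$ such that $\epsilon_A\circ\delta=\mathrm{id}_A$ and $\widetilde{\mathbb{Z}}\mathbb{U}\delta\circ\delta=\Delta_A\circ\delta$; morphisms are morphisms in $\mathsf{sAb}$ commuting with the coactions. $\mathsf{coAlg}_{\mathbb{K}}$ is the category of $\mathbb{K}$-coalgebras.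 The comparison functor is $\mathrm{Can}_{\mathbb{K}}(X)=(\widetilde{\mathbb{Z}}X,\widetilde{\mathbb{Z}}\eta_X)$, with right adjoint $V_{\mathbb{K}}(A,\delta)=\mathrm{equal}(\mathbb{U}\delta,\eta_{\mathbb{U}A}:\mathbb{U}A\rightrightarrows\mathbb{U}\widetilde{\mathbb{Z}}\mathbb{U}A)$. *)

theory Defs
  imports "HOL-Algebra.Free_Abelian_Groups"
begin

section \<open>Categories, functors, natural transformations, adjunctions\<close>

record ('o, 'a) cat =
  Ob :: "'o set"
  Ar :: "'a set"
  Dom :: "'a \<Rightarrow> 'o"
  Cod :: "'a \<Rightarrow> 'o"
  Ide :: "'o \<Rightarrow> 'a"
  Cmp :: "'a \<Rightarrow> 'a \<Rightarrow> 'a"  \<comment> \<open>\<open>Cmp C g f\<close> is \<open>g\<close> after \<open>f\<close>\<close>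

definition Hom :: "('o, 'a) cat \<Rightarrow> 'o \<Rightarrow> 'o \<Rightarrow> 'a set" where
  "Hom C X Y = {f \<in> Ar C. Dom C f = X \<and> Cod C f = Y}"

locale category =
  fixes C :: "('o, 'a) cat"
  assumes dom_cod: "f \<in> Ar C \<Longrightarrow> Dom C f \<in> Ob C \<and> Cod C f \<in> Ob C"
    and ide: "X \<in> Ob C \<Longrightarrow> Ide C X \<in> Hom C X X"
    and cmp: "\<lbrakk>f \<in> Hom C X Y; g \<in> Hom C Y Z\<rbrakk> \<Longrightarrow> Cmp C g f \<in> Hom C X Z"
    and cmp_ide: "f \<in> Hom C X Y \<Longrightarrow> Cmp C f (Ide C X) = f"
    and ide_cmp: "f \<in> Hom C X Y \<Longrightarrow> Cmp C (Ide C Y) f = f"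
    and assoc: "\<lbrakk>f \<in> Hom C W X; g \<in> Hom C X Y; h \<in> Hom C Y Z\<rbrakk>
      \<Longrightarrow> Cmp C h (Cmp C g f) = Cmp C (Cmp C h g) f"

definition isomorphism :: "('o, 'a) cat \<Rightarrow> 'a \<Rightarrow> bool" where
  "isomorphism C f \<longleftrightarrow> f \<in> Ar C \<and>
    (\<exists>g \<in> Hom C (Cod C f) (Dom C f).
      Cmp C g f = Ide C (Dom C f) \<and> Cmp C f g = Ide C (Cod C f))"

definition opposite :: "('o, 'a) cat \<Rightarrow> ('o, 'a) cat" where
  "opposite C = C\<lparr>Dom := Cod C, Cod := Dom C, Cmp := (\<lambda>g f. Cmp C f g)\<rparr>"

record ('o, 'a, 'p, 'b) functr =
  FOb :: "'o \<Rightarrow> 'p"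
  FAr :: "'a \<Rightarrow> 'b"

locale is_functor = source: category C + target: category D
  for C :: "('o, 'a) cat" and D :: "('p, 'b) cat" +
  fixes F :: "('o, 'a, 'p, 'b) functr"
  assumes ob: "X \<in> Ob C \<Longrightarrow> FOb F X \<in> Ob D"
    and ar: "f \<in> Hom C X Y \<Longrightarrow> FAr F f \<in> Hom D (FOb F X) (FOb F Y)"
    and fun_ide: "X \<in> Ob C \<Longrightarrow> FAr F (Ide C X) = Ide D (FOb F X)"
    and fun_cmp: "\<lbrakk>f \<in> Hom C X Y; g \<in> Hom C Y Z\<rbrakk>
      \<Longrightarrow> FAr F (Cmp C g f) = Cmp D (FAr F g) (FAr F f)"

definition id_functor :: "('o, 'a, 'o, 'a) functr" where
  "id_functor = \<lparr>FOb = (\<lambda>X. X), FAr = (\<lambda>f. f)\<rparr>"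

definition comp_functor ::
    "('p, 'b, 'q, 'c) functr \<Rightarrow> ('o, 'a, 'p, 'b) functr \<Rightarrow> ('o, 'a, 'q, 'c) functr" where
  "comp_functor G F = \<lparr>FOb = (\<lambda>X. FOb G (FOb F X)), FAr = (\<lambda>f. FAr G (FAr F f))\<rparr>"

locale nat_trans = source: is_functor C D F + target: is_functor C D G
  for C :: "('o, 'a) cat" and D :: "('p, 'b) cat" and F G +
  fixes t :: "'o \<Rightarrow> 'b"
  assumes component: "X \<in> Ob C \<Longrightarrow> t X \<in> Hom D (FOb F X) (FOb G X)"
    and naturality: "f \<in> Hom C X Y \<Longrightarrow> Cmp D (t Y) (FAr F f) = Cmp D (FAr G f) (t X)"

locale adjunction =
  fixes C :: "('o, 'a) cat" and D :: "('p, 'b) cat"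
    and L :: "('o, 'a, 'p, 'b) functr" and R :: "('p, 'b, 'o, 'a) functr"
    and unt :: "'o \<Rightarrow> 'a" and cnt :: "'p \<Rightarrow> 'b"
  assumes left_functor: "is_functor C D L"
    and right_functor: "is_functor D C R"
    and unit_nat: "nat_trans C C id_functor (comp_functor R L) unt"
    and counit_nat: "nat_trans D D (comp_functor L R) id_functor cnt"
    and triangle_left: "X \<in> Ob C \<Longrightarrow> Cmp D (cnt (FOb L X)) (FAr L (unt X)) = Ide D (FOb L X)"
    and triangle_right: "A \<in> Ob D \<Longrightarrow> Cmp C (FAr R (cnt A)) (unt (FOb R A)) = Ide C (FOb R A)"

text \<open>An adjunction is an equivalence of categories if its unit and counit are isomorphisms.\<close>

locale adjoint_equivalence = adjunction +
  assumes unit_iso: "X \<in> Ob C \<Longrightarrow> isomorphism C (unt X)"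
    and counit_iso: "A \<in> Ob D \<Longrightarrow> isomorphism D (cnt A)"


section \<open>Comonads, coalgebras and the comparison functor\<close>

record ('o, 'a) comonad =
  Endo :: "('o, 'a, 'o, 'a) functr"
  Comult :: "'o \<Rightarrow> 'a"
  Counit :: "'o \<Rightarrow> 'a"

definition adjunction_comonad ::
    "('o, 'a, 'p, 'b) functr \<Rightarrow> ('p, 'b, 'o, 'a) functr \<Rightarrow> ('o \<Rightarrow> 'a) \<Rightarrow> ('p \<Rightarrow> 'b) \<Rightarrow> ('p, 'b) comonad" where
  "adjunction_comonad L R unt cnt =
    \<lparr>Endo = comp_functor L R, Comult = (\<lambda>A. FAr L (unt (FOb R A))), Counit = cnt\<rparr>"

datatype ('o, 'f) arrow = Arrow (src: 'o) (tgt: 'o) (fn: 'f)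

definition coalgebra :: "('o, 'a) cat \<Rightarrow> ('o, 'a) comonad \<Rightarrow> 'o \<Rightarrow> 'a \<Rightarrow> bool" where
  "coalgebra D K A \<delta> \<longleftrightarrow>
    A \<in> Ob D \<and> \<delta> \<in> Hom D A (FOb (Endo K) A) \<and>
    Cmp D (Counit K A) \<delta> = Ide D A \<and>
    Cmp D (FAr (Endo K) \<delta>) \<delta> = Cmp D (Comult K A) \<delta>"

definition coalg_cat ::
    "('o, 'a) cat \<Rightarrow> ('o, 'a) comonad \<Rightarrow> ('o \<times> 'a, ('o \<times> 'a, 'a) arrow) cat" where
  "coalg_cat D K =
    \<lparr>Ob = {(A, \<delta>). coalgebra D K A \<delta>},
     Ar = {Arrow (A, \<delta>) (B, \<gamma>) f | A \<delta> B \<gamma> f.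
             coalgebra D K A \<delta> \<and> coalgebra D K B \<gamma> \<and> f \<in> Hom D A B \<and>
             Cmp D \<gamma> f = Cmp D (FAr (Endo K) f) \<delta>},
     Dom = src, Cod = tgt,
     Ide = (\<lambda>(A, \<delta>). Arrow (A, \<delta>) (A, \<delta>) (Ide D A)),
     Cmp = (\<lambda>g f. Arrow (src f) (tgt g) (Cmp D (fn g) (fn f)))\<rparr>"

definition comparison ::
    "('o, 'a) cat \<Rightarrow> ('o, 'a, 'p, 'b) functr \<Rightarrow> ('o \<Rightarrow> 'a)
      \<Rightarrow> ('o, 'a, 'p \<times> 'b, ('p \<times> 'b, 'b) arrow) functr" where
  "comparison C L unt =
    (let can = (\<lambda>X. (FOb L X, FAr L (unt X)))
     in \<lparr>FOb = can, FAr = (\<lambda>f. Arrow (can (Dom C f)) (can (Cod C f)) (FAr L f))\<rparr>)"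


section \<open>Functor categories and simplicial objects\<close>

text \<open>
  Functions on objects and arrows are required to be \<^const>\<open>extensional\<close>, so that equality
  in a functor category is equality on actual objects and arrows.
\<close>

definition functor_cat :: "('o, 'a) cat \<Rightarrow> ('p, 'b) cat
    \<Rightarrow> (('o, 'a, 'p, 'b) functr, (('o, 'a, 'p, 'b) functr, 'o \<Rightarrow> 'b) arrow) cat" where
  "functor_cat J D =
    \<lparr>Ob = {F. is_functor J D F \<and> FOb F \<in> extensional (Ob J) \<and> FAr F \<in> extensional (Ar J)},
     Ar = {Arrow F G t | F G t.
             FOb F \<in> extensional (Ob J) \<and> FAr F \<in> extensional (Ar J) \<and>
             FOb G \<in> extensional (Ob J) \<and> FAr G \<in> extensional (Ar J) \<and>
             nat_trans J D F G t \<and> t \<in> extensional (Ob J)},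
     Dom = src, Cod = tgt,
     Ide = (\<lambda>F. Arrow F F (\<lambda>j\<in>Ob J. Ide D (FOb F j))),
     Cmp = (\<lambda>g f. Arrow (src f) (tgt g) (\<lambda>j\<in>Ob J. Cmp D (fn g j) (fn f j)))\<rparr>"

text \<open>The simplex category: the object \<open>n\<close> stands for \<open>[n] = {0 < \<dots> < n}\<close>.\<close>

definition simplex_cat :: "(nat, (nat, nat \<Rightarrow> nat) arrow) cat" where
  "simplex_cat =
    \<lparr>Ob = UNIV,
     Ar = {Arrow m n \<theta> | m n \<theta>. \<theta> \<in> {..m} \<rightarrow>\<^sub>E {..n} \<and> mono_on {..m} \<theta>},
     Dom = src, Cod = tgt,
     Ide = (\<lambda>n. Arrow n n (\<lambda>i\<in>{..n}. i)),
     Cmp = (\<lambda>g f. Arrow (src f) (tgt g) (compose {..src f} (fn g) (fn f)))\<rparr>"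

type_synonym ('p, 'b) simplicial_object = "(nat, (nat, nat \<Rightarrow> nat) arrow, 'p, 'b) functr"
type_synonym ('p, 'b) simplicial_map = "(('p, 'b) simplicial_object, nat \<Rightarrow> 'b) arrow"

definition simplicial :: "('p, 'b) cat \<Rightarrow> (('p, 'b) simplicial_object, ('p, 'b) simplicial_map) cat" where
  "simplicial D = functor_cat (opposite simplex_cat) D"

definition levelwise_ob ::
    "('p, 'b, 'q, 'c) functr \<Rightarrow> ('p, 'b) simplicial_object \<Rightarrow> ('q, 'c) simplicial_object" where
  "levelwise_ob T X =
    \<lparr>FOb = (\<lambda>n. FOb T (FOb X n)), FAr = (\<lambda>\<theta>\<in>Ar simplex_cat. FAr T (FAr X \<theta>))\<rparr>"

definition levelwise :: "('p, 'b, 'q, 'c) functr \<Rightarrow>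
    (('p, 'b) simplicial_object, ('p, 'b) simplicial_map,
     ('q, 'c) simplicial_object, ('q, 'c) simplicial_map) functr" where
  "levelwise T =
    \<lparr>FOb = levelwise_ob T,
     FAr = (\<lambda>f. Arrow (levelwise_ob T (src f)) (levelwise_ob T (tgt f)) (\<lambda>n. FAr T (fn f n)))\<rparr>"

definition levelwise_trans ::
    "('p, 'b, 'q, 'c) functr \<Rightarrow> ('p, 'b, 'q, 'c) functr \<Rightarrow> ('p \<Rightarrow> 'c)
      \<Rightarrow> ('p, 'b) simplicial_object \<Rightarrow> ('q, 'c) simplicial_map" where
  "levelwise_trans S T t X =
    Arrow (levelwise_ob S X) (levelwise_ob T X) (\<lambda>n. t (FOb X n))"


section \<open>Pointed sets and abelian groups\<close>

text \<open>All sets are subsets of a type \<open>'u\<close>, which plays the role of the universe.\<close>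

datatype 'u pset = Pset (points: "'u set") (base: 'u)

definition pset_cat :: "('u pset, ('u pset, 'u \<Rightarrow> 'u) arrow) cat" where
  "pset_cat =
    \<lparr>Ob = {S. base S \<in> points S},
     Ar = {Arrow S T f | S T f. base S \<in> points S \<and> base T \<in> points T \<and>
             f \<in> points S \<rightarrow>\<^sub>E points T \<and> f (base S) = base T},
     Dom = src, Cod = tgt,
     Ide = (\<lambda>S. Arrow S S (\<lambda>x\<in>points S. x)),
     Cmp = (\<lambda>g f. Arrow (src f) (tgt g) (compose (points (src f)) (fn g) (fn f)))\<rparr>"

text \<open>Abelian groups are written multiplicatively, as in \<^locale>\<open>comm_group\<close>.\<close>

definition ab_cat :: "('u monoid, ('u monoid, 'u \<Rightarrow> 'u) arrow) cat" where
  "ab_cat =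
    \<lparr>Ob = {A. comm_group A},
     Ar = {Arrow A B f | A B f. comm_group A \<and> comm_group B \<and>
             f \<in> hom A B \<and> f \<in> extensional (carrier A)},
     Dom = src, Cod = tgt,
     Ide = (\<lambda>A. Arrow A A (\<lambda>x\<in>carrier A. x)),
     Cmp = (\<lambda>g f. Arrow (src f) (tgt g) (compose (carrier (src f)) (fn g) (fn f)))\<rparr>"

definition forget_ob :: "'u monoid \<Rightarrow> 'u pset" where
  "forget_ob A = Pset (carrier A) \<one>\<^bsub>A\<^esub>"

definition forget :: "('u monoid, ('u monoid, 'u \<Rightarrow> 'u) arrow,
    'u pset, ('u pset, 'u \<Rightarrow> 'u) arrow) functr" where
  "forget =
    \<lparr>FOb = forget_ob, FAr = (\<lambda>f. Arrow (forget_ob (src f)) (forget_ob (tgt f)) (fn f))\<rparr>"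


section \<open>The reduced free abelian group\<close>

definition quotient_free :: "'u pset \<Rightarrow> ('u \<Rightarrow>\<^sub>0 int) set monoid" where
  "quotient_free S = free_Abelian_group (points S) Mod carrier (free_Abelian_group {base S})"

text \<open>
  The elements of the quotient are cosets. To obtain a functor into the abelian groups
  whose elements lie in \<open>'u\<close>, they are renamed along a map \<open>enc\<close> that is injective on all
  cosets that occur.
\<close>

definition reduced_cosets :: "('u \<Rightarrow>\<^sub>0 int) set set" where
  "reduced_cosets = (\<Union>S \<in> Ob pset_cat. carrier (quotient_free S))"

definition coset_coding :: "(('u \<Rightarrow>\<^sub>0 int) set \<Rightarrow> 'u) \<Rightarrow> bool" where
  "coset_coding enc \<longleftrightarrow> inj_on enc reduced_cosets"

lemma coset_coding_exists:
  assumes inf: "infinite (UNIV :: 'u set)"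
  shows "\<exists>enc :: ('u \<Rightarrow>\<^sub>0 int) set \<Rightarrow> 'u. coset_coding enc"
proof -
  let ?g = "\<lambda>(b :: 'u, c). carrier (free_Abelian_group {b}) #>\<^bsub>free_Abelian_group UNIV\<^esub> c"
  have "x \<in> range ?g" if "x \<in> reduced_cosets" for x
  proof -
    from that obtain b S c where
      "x = carrier (free_Abelian_group {b}) #>\<^bsub>free_Abelian_group S\<^esub> c"
      by (auto simp: reduced_cosets_def quotient_free_def carrier_FactGroup)
    then have "x = ?g (b, c)" by (simp add: r_coset_def)
    then show ?thesis by blast
  qed
  then have "reduced_cosets \<subseteq> range ?g"
    by (rule subsetI)
  then have "(reduced_cosets :: ('u \<Rightarrow>\<^sub>0 int) set set) \<lesssim> range ?g"
    by (rule subset_imp_lepoll)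
  also have "range ?g \<lesssim> (UNIV :: ('u \<times> ('u \<Rightarrow>\<^sub>0 int)) set)"
    by (rule image_lepoll)
  also have "\<dots> \<approx> (UNIV :: ('u \<times> 'u) set)"
    using times_eqpoll_cong[OF eqpoll_refl[of "UNIV :: 'u set"] eqpoll_free_Abelian_group_infinite[OF inf]]
    by (simp add: free_Abelian_group_def flip: UNIV_Times_UNIV)
  also have "\<dots> \<approx> (UNIV :: 'u set)"
    using card_of_Times_same_infinite[OF inf] by (simp add: eqpoll_iff_card_of_ordIso)
  finally obtain enc :: "('u \<Rightarrow>\<^sub>0 int) set \<Rightarrow> 'u" where "inj_on enc reduced_cosets"
    unfolding lepoll_def by blast
  then show ?thesis
    unfolding coset_coding_def by blast
qed

definition dec :: "(('u \<Rightarrow>\<^sub>0 int) set \<Rightarrow> 'u) \<Rightarrow> 'u \<Rightarrow> ('u \<Rightarrow>\<^sub>0 int) set" where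
  "dec enc = inv_into reduced_cosets enc"

definition reduced_free_ob :: "(('u \<Rightarrow>\<^sub>0 int) set \<Rightarrow> 'u) \<Rightarrow> 'u pset \<Rightarrow> 'u monoid" where
  "reduced_free_ob enc S =
    \<lparr>carrier = enc ` carrier (quotient_free S),
     mult = (\<lambda>u v. enc (dec enc u \<otimes>\<^bsub>quotient_free S\<^esub> dec enc v)),
     one = enc \<one>\<^bsub>quotient_free S\<^esub>\<rparr>"

text \<open>
  The image of a coset of \<open>\<int>(*)\<close> under the homomorphism of free abelian groups
  induced by a pointed map is again a coset of \<open>\<int>(*)\<close>.
\<close>

definition reduced_free :: "(('u \<Rightarrow>\<^sub>0 int) set \<Rightarrow> 'u) \<Rightarrow>
    ('u pset, ('u pset, 'u \<Rightarrow> 'u) arrow, 'u monoid, ('u monoid, 'u \<Rightarrow> 'u) arrow) functr" where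
  "reduced_free enc =
    \<lparr>FOb = reduced_free_ob enc,
     FAr = (\<lambda>f. Arrow (reduced_free_ob enc (src f)) (reduced_free_ob enc (tgt f))
       (\<lambda>u\<in>carrier (reduced_free_ob enc (src f)).
          enc (frag_extend (\<lambda>x. frag_of (fn f x)) ` dec enc u)))\<rparr>"

definition hurewicz :: "(('u \<Rightarrow>\<^sub>0 int) set \<Rightarrow> 'u) \<Rightarrow> 'u pset \<Rightarrow> ('u pset, 'u \<Rightarrow> 'u) arrow" where
  "hurewicz enc S =
    Arrow S (forget_ob (reduced_free_ob enc S))
      (\<lambda>x\<in>points S.
         enc (carrier (free_Abelian_group {base S}) #>\<^bsub>free_Abelian_group (points S)\<^esub> frag_of x))"

definition evaluate :: "'u monoid \<Rightarrow> ('u \<Rightarrow>\<^sub>0 int) \<Rightarrow> 'u" where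
  "evaluate A c =
    (\<Otimes>\<^bsub>A\<^esub>x\<in>Poly_Mapping.keys c. x [^]\<^bsub>A\<^esub> (Poly_Mapping.lookup c x :: int))"

text \<open>As \<^const>\<open>evaluate\<close> is constant on cosets, the image of a coset is a singleton.\<close>

definition linearize :: "(('u \<Rightarrow>\<^sub>0 int) set \<Rightarrow> 'u) \<Rightarrow> 'u monoid \<Rightarrow> ('u monoid, 'u \<Rightarrow> 'u) arrow" where
  "linearize enc A =
    Arrow (reduced_free_ob enc (forget_ob A)) A
      (\<lambda>u\<in>carrier (reduced_free_ob enc (forget_ob A)). the_elem (evaluate A ` dec enc u))"


section \<open>The comonad on simplicial abelian groups\<close>

type_synonym 'u spset = "('u pset, ('u pset, 'u \<Rightarrow> 'u) arrow) simplicial_object"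
type_synonym 'u spset_map = "('u pset, ('u pset, 'u \<Rightarrow> 'u) arrow) simplicial_map"
type_synonym 'u sab = "('u monoid, ('u monoid, 'u \<Rightarrow> 'u) arrow) simplicial_object"
type_synonym 'u sab_map = "('u monoid, ('u monoid, 'u \<Rightarrow> 'u) arrow) simplicial_map"

definition sSet_pointed :: "('u spset, 'u spset_map) cat" where
  "sSet_pointed = simplicial pset_cat"

definition sAb :: "('u sab, 'u sab_map) cat" where
  "sAb = simplicial ab_cat"

definition Z_tilde :: "(('u \<Rightarrow>\<^sub>0 int) set \<Rightarrow> 'u) \<Rightarrow> ('u spset, 'u spset_map, 'u sab, 'u sab_map) functr" where
  "Z_tilde enc = levelwise (reduced_free enc)"

definition U_functor :: "('u sab, 'u sab_map, 'u spset, 'u spset_map) functr" where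
  "U_functor = levelwise forget"

definition eta :: "(('u \<Rightarrow>\<^sub>0 int) set \<Rightarrow> 'u) \<Rightarrow> 'u spset \<Rightarrow> 'u spset_map" where
  "eta enc = levelwise_trans id_functor (comp_functor forget (reduced_free enc)) (hurewicz enc)"

definition eps :: "(('u \<Rightarrow>\<^sub>0 int) set \<Rightarrow> 'u) \<Rightarrow> 'u sab \<Rightarrow> 'u sab_map" where
  "eps enc = levelwise_trans (comp_functor (reduced_free enc) forget) id_functor (linearize enc)"

definition K_comonad :: "(('u \<Rightarrow>\<^sub>0 int) set \<Rightarrow> 'u) \<Rightarrow> ('u sab, 'u sab_map) comonad" where
  "K_comonad enc = adjunction_comonad (Z_tilde enc) U_functor (eta enc) (eps enc)"

type_synonym 'u coalg = "'u sab \<times> 'u sab_map"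
type_synonym 'u coalg_map = "('u coalg, 'u sab_map) arrow"

definition coAlg :: "(('u \<Rightarrow>\<^sub>0 int) set \<Rightarrow> 'u) \<Rightarrow> ('u coalg, 'u coalg_map) cat" where
  "coAlg enc = coalg_cat sAb (K_comonad enc)"


section \<open>The comparison adjunction\<close>

definition Can :: "(('u \<Rightarrow>\<^sub>0 int) set \<Rightarrow> 'u)
    \<Rightarrow> ('u spset, 'u spset_map, 'u coalg, 'u coalg_map) functr" where
  "Can enc = comparison sSet_pointed (Z_tilde enc) (eta enc)"

text \<open>The equalizer of two parallel maps of pointed simplicial sets, with its inclusion.\<close>

definition equalizer_level :: "'u spset_map \<Rightarrow> 'u spset_map \<Rightarrow> nat \<Rightarrow> 'u pset" where
  "equalizer_level f g n =
    Pset {x \<in> points (FOb (src f) n). fn (fn f n) x = fn (fn g n) x} (base (FOb (src f) n))"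

definition equalizer :: "'u spset_map \<Rightarrow> 'u spset_map \<Rightarrow> 'u spset" where
  "equalizer f g =
    \<lparr>FOb = equalizer_level f g,
     FAr = (\<lambda>\<theta>\<in>Ar simplex_cat.
       Arrow (equalizer_level f g (tgt \<theta>)) (equalizer_level f g (src \<theta>))
         (restrict (fn (FAr (src f) \<theta>)) (points (equalizer_level f g (tgt \<theta>)))))\<rparr>"

definition equalizer_incl :: "'u spset_map \<Rightarrow> 'u spset_map \<Rightarrow> 'u spset_map" where
  "equalizer_incl f g =
    Arrow (equalizer f g) (src f)
      (\<lambda>n. Arrow (equalizer_level f g n) (FOb (src f) n) (\<lambda>x\<in>points (equalizer_level f g n). x))"

definition V_ob :: "(('u \<Rightarrow>\<^sub>0 int) set \<Rightarrow> 'u) \<Rightarrow> 'u coalg \<Rightarrow> 'u spset" where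
  "V_ob enc = (\<lambda>(A, \<delta>). equalizer (FAr U_functor \<delta>) (eta enc (FOb U_functor A)))"

definition V_incl :: "(('u \<Rightarrow>\<^sub>0 int) set \<Rightarrow> 'u) \<Rightarrow> 'u coalg \<Rightarrow> 'u spset_map" where
  "V_incl enc = (\<lambda>(A, \<delta>). equalizer_incl (FAr U_functor \<delta>) (eta enc (FOb U_functor A)))"

text \<open>On morphisms, the right adjoint is the restriction of the underlying map to the equalizers.\<close>

definition V_functor :: "(('u \<Rightarrow>\<^sub>0 int) set \<Rightarrow> 'u)
    \<Rightarrow> ('u coalg, 'u coalg_map, 'u spset, 'u spset_map) functr" where
  "V_functor enc =
    \<lparr>FOb = V_ob enc,
     FAr = (\<lambda>f. Arrow (V_ob enc (src f)) (V_ob enc (tgt f))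
       (\<lambda>n. Arrow (FOb (V_ob enc (src f)) n) (FOb (V_ob enc (tgt f)) n)
         (restrict (fn (fn (FAr U_functor (fn f)) n)) (points (FOb (V_ob enc (src f)) n)))))\<rparr>"

text \<open>The unit is \<^const>\<open>eta\<close> with codomain restricted to the equalizer.\<close>

definition comparison_unit :: "(('u \<Rightarrow>\<^sub>0 int) set \<Rightarrow> 'u) \<Rightarrow> 'u spset \<Rightarrow> 'u spset_map" where
  "comparison_unit enc X =
    (let W = FOb (V_functor enc) (FOb (Can enc) X)
     in Arrow X W (\<lambda>n. Arrow (FOb X n) (FOb W n) (fn (fn (eta enc X) n))))"

text \<open>The counit is the adjunct of the inclusion of the equalizer.\<close>

definition comparison_counit :: "(('u \<Rightarrow>\<^sub>0 int) set \<Rightarrow> 'u) \<Rightarrow> 'u coalg \<Rightarrow> 'u coalg_map" where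
  "comparison_counit enc P =
    Arrow (FOb (Can enc) (FOb (V_functor enc) P)) P
      (Cmp sAb (eps enc (fst P)) (FAr (Z_tilde enc) (V_incl enc P)))"

end

theory Submission
  imports Defs
begin

text \<open>
  The adjunction and both isomorphisms are checked in each simplicial degree. Let \<open>\<delta>\<close> be a
  coaction on an abelian group \<open>A\<close>, and call \<open>x\<close> group-like if \<open>\<delta> x = [x]\<close>. Comparing coefficients
  in the coassociativity law shows that \<open>\<delta> a\<close> is a combination of classes of group-like elements
  for every \<open>a\<close>. Since \<open>\<delta>\<close> is split by evaluation, \<open>A\<close> is therefore freely generated by its
  pointed set of group-like elements, which is the equalizer defining the right adjoint. Dually,
  the group-like elements of a reduced free abelian group are exactly its generators and \<open>0\<close>.
\<close>

section \<open>Functor categories\<close>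

text \<open>Comparing coefficients takes the place of an appeal to a comonadicity theorem. It rests
  on the absence of cancellation: distinct points have distinct classes, and the classes of points
  other than the base point form a basis, so every coefficient of a sum of n_i [[x_i]] can be read
  off. The sum of n_i [\<delta> x_i] on the other side of coassociativity might a priori merge
  terms, but only its support is used. The delicate point is the base point. Its class is zero, so
  coefficients are visible only away from it; representatives are therefore first normalised to have
  no term there. Passing from groups to simplicial groups needs no further construction: inverses
  found degree by degree are automatically compatible with the simplicial operators, and the inverse
  of a coalgebra map is automatically compatible with the coactions. The formal part is kept
  separate and sees the equalizer only through its monic inclusion and the lifts along it.\<close>

lemma in_Hom_iff: "f \<in> Hom C X Y \<longleftrightarrow> f \<in> Ar C \<and> Dom C f = X \<and> Cod C f = Y"
  by (auto simp: Hom_def)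

lemma Hom_Ob: "category C \<Longrightarrow> f \<in> Hom C X Y \<Longrightarrow> X \<in> Ob C \<and> Y \<in> Ob C"
  by (auto simp: Hom_def dest: category.dom_cod)

lemma is_functorI:
  assumes "category C" "category D"
    and "\<And>X. X \<in> Ob C \<Longrightarrow> FOb F X \<in> Ob D"
    and "\<And>f X Y. f \<in> Hom C X Y \<Longrightarrow> FAr F f \<in> Hom D (FOb F X) (FOb F Y)"
    and "\<And>X. X \<in> Ob C \<Longrightarrow> FAr F (Ide C X) = Ide D (FOb F X)"
    and "\<And>f g X Y Z. f \<in> Hom C X Y \<Longrightarrow> g \<in> Hom C Y Z \<Longrightarrow>
      FAr F (Cmp C g f) = Cmp D (FAr F g) (FAr F f)"
  shows "is_functor C D F"
  using assms by (intro is_functor.intro is_functor_axioms.intro) auto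

lemma nat_transI:
  assumes "is_functor C D F" "is_functor C D G"
    and "\<And>X. X \<in> Ob C \<Longrightarrow> t X \<in> Hom D (FOb F X) (FOb G X)"
    and "\<And>f X Y. f \<in> Hom C X Y \<Longrightarrow> Cmp D (t Y) (FAr F f) = Cmp D (FAr G f) (t X)"
  shows "nat_trans C D F G t"
  using assms by (intro nat_trans.intro nat_trans_axioms.intro) auto

lemma Hom_opposite [simp]: "Hom (opposite C) X Y = Hom C Y X"
  by (auto simp: Hom_def opposite_def)

lemma opposite_sel [simp]:
  "Ob (opposite C) = Ob C" "Ar (opposite C) = Ar C" "Ide (opposite C) = Ide C"
  "Dom (opposite C) = Cod C" "Cod (opposite C) = Dom C" "Cmp (opposite C) g f = Cmp C f g"
  by (auto simp: opposite_def)

lemma category_opposite: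
  assumes "category C"
  shows "category (opposite C)"
proof -
  interpret category C by fact
  show ?thesis
    by (rule category.intro) (auto simp: dom_cod ide cmp cmp_ide ide_cmp assoc)
qed

lemma is_functor_id: "category C \<Longrightarrow> is_functor C C id_functor"
  by (rule is_functorI) (auto simp: id_functor_def)

lemma is_functor_comp:
  assumes "is_functor C D F" "is_functor D E G"
  shows "is_functor C E (comp_functor G F)"
proof -
  interpret F: is_functor C D F by fact
  interpret G: is_functor D E G by fact
  show ?thesis
    by (rule is_functorI)
      (auto simp: comp_functor_def F.source.category_axioms G.target.category_axioms
        F.ob G.ob F.fun_ide G.fun_ide intro: F.ar G.ar dest: F.ar
        simp flip: G.fun_cmp[OF F.ar F.ar] F.fun_cmp)
qed

lemma nat_trans_ide:
  assumes "is_functor C D F"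
  shows "nat_trans C D F F (\<lambda>X. Ide D (FOb F X))"
proof -
  interpret F: is_functor C D F by fact
  show ?thesis
    by (rule nat_transI)
      (auto simp: assms F.target.ide F.ob F.target.cmp_ide[OF F.ar] F.target.ide_cmp[OF F.ar])
qed

lemma nat_trans_vcomp:
  assumes "nat_trans C D F G s" "nat_trans C D G H t"
  shows "nat_trans C D F H (\<lambda>X. Cmp D (t X) (s X))"
proof -
  interpret s: nat_trans C D F G s by fact
  interpret t: nat_trans C D G H t by fact
  show ?thesis
  proof (rule nat_transI)
    fix X assume "X \<in> Ob C"
    then show "Cmp D (t X) (s X) \<in> Hom D (FOb F X) (FOb H X)"
      by (blast intro: s.source.target.cmp s.component t.component)
  next
    fix f X Y assume f: "f \<in> Hom C X Y"
    then have X: "X \<in> Ob C" and Y: "Y \<in> Ob C"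
      using Hom_Ob[OF s.source.source.category_axioms f] by blast+
    have "Cmp D (Cmp D (t Y) (s Y)) (FAr F f) = Cmp D (t Y) (Cmp D (s Y) (FAr F f))"
      by (rule s.source.target.assoc[symmetric, OF s.source.ar[OF f] s.component[OF Y] t.component[OF Y]])
    also have "\<dots> = Cmp D (Cmp D (t Y) (FAr G f)) (s X)"
      unfolding s.naturality[OF f]
      by (rule s.source.target.assoc[OF s.component[OF X] s.target.ar[OF f] t.component[OF Y]])
    also have "\<dots> = Cmp D (FAr H f) (Cmp D (t X) (s X))"
      unfolding t.naturality[OF f]
      by (rule s.source.target.assoc[symmetric, OF s.component[OF X] t.component[OF X] t.target.ar[OF f]])
    finally show "Cmp D (Cmp D (t Y) (s Y)) (FAr F f) = Cmp D (FAr H f) (Cmp D (t X) (s X))" .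
  qed (fact s.source.is_functor_axioms t.target.is_functor_axioms)+
qed

text \<open>Arrows of a functor category are extensional, so identities and composites there are
  restrictions to the objects. This carries naturality over from the unrestricted families of
  components.\<close>

lemma nat_trans_cong:
  assumes "nat_trans C D F G t" "\<And>X. X \<in> Ob C \<Longrightarrow> t' X = t X"
  shows "nat_trans C D F G t'"
proof -
  interpret t: nat_trans C D F G t by fact
  show ?thesis
  proof (rule nat_transI)
    fix f X Y assume f: "f \<in> Hom C X Y"
    then have "X \<in> Ob C" "Y \<in> Ob C"
      using Hom_Ob[OF t.source.source.category_axioms f] by blast+
    then show "Cmp D (t' Y) (FAr F f) = Cmp D (FAr G f) (t' X)"
      by (simp add: assms t.naturality[OF f])
  qed (auto simp: assms t.source.is_functor_axioms t.target.is_functor_axioms intro: t.component)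
qed

lemma Ob_functor_cat:
  "F \<in> Ob (functor_cat J D) \<longleftrightarrow>
    is_functor J D F \<and> FOb F \<in> extensional (Ob J) \<and> FAr F \<in> extensional (Ar J)"
  by (simp add: functor_cat_def)

lemma Hom_functor_cat:
  "f \<in> Hom (functor_cat J D) F G \<longleftrightarrow>
    F \<in> Ob (functor_cat J D) \<and> G \<in> Ob (functor_cat J D) \<and> src f = F \<and> tgt f = G \<and>
    nat_trans J D F G (fn f) \<and> fn f \<in> extensional (Ob J)"
  by (cases f) (auto simp: functor_cat_def Hom_def nat_trans_def)

lemma functor_cat_sel [simp]:
  "Dom (functor_cat J D) = src" "Cod (functor_cat J D) = tgt"
  "Ide (functor_cat J D) F = Arrow F F (\<lambda>j\<in>Ob J. Ide D (FOb F j))"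
  "Cmp (functor_cat J D) g f = Arrow (src f) (tgt g) (\<lambda>j\<in>Ob J. Cmp D (fn g j) (fn f j))"
  by (simp_all add: functor_cat_def)

lemma category_functor_cat:
  assumes "category J" "category D"
  shows "category (functor_cat J D)"
proof -
  interpret D: category D by fact
  note c = nat_trans.component
  show ?thesis
  proof (rule category.intro)
    fix f assume "f \<in> Ar (functor_cat J D)"
    then have "f \<in> Hom (functor_cat J D) (src f) (tgt f)" by (simp add: in_Hom_iff)
    then show "Dom (functor_cat J D) f \<in> Ob (functor_cat J D) \<and> Cod (functor_cat J D) f \<in> Ob (functor_cat J D)"
      by (simp add: Hom_functor_cat)
  next
    fix X assume "X \<in> Ob (functor_cat J D)"
    then show "Ide (functor_cat J D) X \<in> Hom (functor_cat J D) X X"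
      by (auto simp: Hom_functor_cat Ob_functor_cat intro: nat_trans_cong[OF nat_trans_ide])
  next
    fix f g X Y Z assume "f \<in> Hom (functor_cat J D) X Y" "g \<in> Hom (functor_cat J D) Y Z"
    then show "Cmp (functor_cat J D) g f \<in> Hom (functor_cat J D) X Z"
      by (auto simp: Hom_functor_cat intro: nat_trans_cong[OF nat_trans_vcomp])
  next
    fix f X Y assume f: "f \<in> Hom (functor_cat J D) X Y"
    then have "fn f j \<in> Hom D (FOb X j) (FOb Y j)" if "j \<in> Ob J" for j
      using that by (auto simp: Hom_functor_cat intro: c)
    with f show "Cmp (functor_cat J D) f (Ide (functor_cat J D) X) = f"
      "Cmp (functor_cat J D) (Ide (functor_cat J D) Y) f = f"
      by (cases f; fastforce simp: Hom_functor_cat D.cmp_ide D.ide_cmp intro!: ext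
          simp: extensional_def)+
  next
    fix f g h W X Y Z assume f: "f \<in> Hom (functor_cat J D) W X" "g \<in> Hom (functor_cat J D) X Y"
      "h \<in> Hom (functor_cat J D) Y Z"
    then have "fn f j \<in> Hom D (FOb W j) (FOb X j)" "fn g j \<in> Hom D (FOb X j) (FOb Y j)"
       "fn h j \<in> Hom D (FOb Y j) (FOb Z j)" if "j \<in> Ob J" for j
      using that by (auto simp: Hom_functor_cat intro: c)
    then have "Cmp D (fn h j) (Cmp D (fn g j) (fn f j)) = Cmp D (Cmp D (fn h j) (fn g j)) (fn f j)"
      if "j \<in> Ob J" for j
      using that by (blast intro: D.assoc)
    then show "Cmp (functor_cat J D) h (Cmp (functor_cat J D) g f) =
      Cmp (functor_cat J D) (Cmp (functor_cat J D) h g) f"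
      by (auto intro!: ext simp: restrict_def)
  qed
qed

section \<open>Simplicial objects\<close>

lemma simplex_cat_sel [simp]:
  "Ob simplex_cat = UNIV" "Dom simplex_cat = src" "Cod simplex_cat = tgt"
  "Ide simplex_cat n = Arrow n n (\<lambda>i\<in>{..n}. i)"
  "Cmp simplex_cat g f = Arrow (src f) (tgt g) (compose {..src f} (fn g) (fn f))"
  by (simp_all add: simplex_cat_def)

lemma Hom_simplex_cat:
  "\<theta> \<in> Hom simplex_cat m n \<longleftrightarrow>
    src \<theta> = m \<and> tgt \<theta> = n \<and> fn \<theta> \<in> {..m} \<rightarrow>\<^sub>E {..n} \<and> mono_on {..m} (fn \<theta>)"
  by (cases \<theta>) (auto simp: simplex_cat_def Hom_def)

lemma Ar_simplex_cat_iff: "\<theta> \<in> Ar simplex_cat \<longleftrightarrow> \<theta> \<in> Hom simplex_cat (src \<theta>) (tgt \<theta>)"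
  by (simp add: in_Hom_iff)

lemma compose_restrict_id: "f \<in> A \<rightarrow>\<^sub>E B \<Longrightarrow> compose A f (\<lambda>x\<in>A. x) = f"
  by (auto simp: compose_def PiE_def extensional_def)

lemma compose_id_restrict: "f \<in> A \<rightarrow>\<^sub>E B \<Longrightarrow> compose A (\<lambda>x\<in>B. x) f = f"
  by (rule ext) (auto simp: compose_def PiE_def extensional_def Pi_def)

lemma compose_in_PiE: "f \<in> A \<rightarrow>\<^sub>E B \<Longrightarrow> g \<in> B \<rightarrow>\<^sub>E C \<Longrightarrow> compose A g f \<in> A \<rightarrow>\<^sub>E C"
  by (auto simp: compose_def PiE_iff)

lemma compose_assoc_PiE:
  "f \<in> A \<rightarrow>\<^sub>E B \<Longrightarrow> compose A h (compose A g f) = compose A (compose B h g) f"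
  by (rule ext) (auto simp: compose_def PiE_def Pi_def)

lemma category_simplex_cat: "category simplex_cat"
proof (rule category.intro)
  fix f g X Y Z assume fg: "f \<in> Hom simplex_cat X Y" "g \<in> Hom simplex_cat Y Z"
  then have "compose {..X} (fn g) (fn f) \<in> {..X} \<rightarrow>\<^sub>E {..Z}"
    by (intro compose_in_PiE[of _ _ "{..Y}"]) (simp_all add: Hom_simplex_cat)
  moreover have "mono_on {..X} (compose {..X} (fn g) (fn f))"
    using fg by (auto simp: Hom_simplex_cat compose_def mono_on_def PiE_iff)
  ultimately show "Cmp simplex_cat g f \<in> Hom simplex_cat X Z"
    using fg by (simp add: Hom_simplex_cat)
qed (auto simp: Ar_simplex_cat_iff Hom_simplex_cat compose_restrict_id compose_id_restrict
    compose_assoc_PiE mono_on_def arrow.expand)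

lemma category_simplicial: "category D \<Longrightarrow> category (simplicial D)"
  unfolding simplicial_def
  by (intro category_functor_cat category_opposite category_simplex_cat)

text \<open>Every natural number is an object of the simplex category, so extensionality on objects
  holds trivially here and in the description of the arrows below. On arrows of
  \<open>simplex_cat\<close> it remains a real condition.\<close>

lemma Ob_simplicial:
  "X \<in> Ob (simplicial D) \<longleftrightarrow>
    is_functor (opposite simplex_cat) D X \<and> FAr X \<in> extensional (Ar simplex_cat)"
  by (simp add: simplicial_def Ob_functor_cat)

lemma Hom_simplicial:
  "f \<in> Hom (simplicial D) X Y \<longleftrightarrow>
    X \<in> Ob (simplicial D) \<and> Y \<in> Ob (simplicial D) \<and> src f = X \<and> tgt f = Y \<and>
    nat_trans (opposite simplex_cat) D X Y (fn f)"
  by (simp add: simplicial_def Hom_functor_cat)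

lemma simplicial_sel [simp]:
  "Dom (simplicial D) = src" "Cod (simplicial D) = tgt"
  "Ide (simplicial D) F = Arrow F F (\<lambda>n. Ide D (FOb F n))"
  "Cmp (simplicial D) g f = Arrow (src f) (tgt g) (\<lambda>n. Cmp D (fn g n) (fn f n))"
  by (simp_all add: simplicial_def restrict_UNIV)

text \<open>An operator \<theta> from m to n acts from degree n to degree m, hence the exchange of m
  and n in the square.\<close>

lemma simplicial_mapI:
  assumes "X \<in> Ob (simplicial D)" "Y \<in> Ob (simplicial D)"
    and "\<And>n. t n \<in> Hom D (FOb X n) (FOb Y n)"
    and "\<And>\<theta> m n. \<theta> \<in> Hom simplex_cat m n \<Longrightarrow> Cmp D (t m) (FAr X \<theta>) = Cmp D (FAr Y \<theta>) (t n)"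
  shows "Arrow X Y t \<in> Hom (simplicial D) X Y"
  using assms by (auto simp: Hom_simplicial Ob_simplicial intro!: nat_transI)

lemma simplicial_map_level:
  "f \<in> Hom (simplicial D) X Y \<Longrightarrow> fn f n \<in> Hom D (FOb X n) (FOb Y n)"
  by (auto simp: Hom_simplicial intro: nat_trans.component)

lemma simplicial_map_natural:
  "f \<in> Hom (simplicial D) X Y \<Longrightarrow> \<theta> \<in> Hom simplex_cat m n \<Longrightarrow>
    Cmp D (fn f m) (FAr X \<theta>) = Cmp D (FAr Y \<theta>) (fn f n)"
  by (auto simp: Hom_simplicial dest: nat_trans.naturality)

lemma simplicial_ob_level: "X \<in> Ob (simplicial D) \<Longrightarrow> FOb X n \<in> Ob D"
  by (auto simp: Ob_simplicial dest: is_functor.ob)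

lemma simplicial_ob_arrow:
  "X \<in> Ob (simplicial D) \<Longrightarrow> \<theta> \<in> Hom simplex_cat m n \<Longrightarrow> FAr X \<theta> \<in> Hom D (FOb X n) (FOb X m)"
  by (auto simp: Ob_simplicial dest: is_functor.ar)

text \<open>\<open>levelwise_ob\<close> cuts the action off outside the arrows of the simplex
  category. It returns X itself, and not merely a functor that agrees with X, because X is
  extensional.\<close>

lemma levelwise_ob_id: "X \<in> Ob (simplicial C) \<Longrightarrow> levelwise_ob id_functor X = X"
  by (cases X) (auto simp: levelwise_ob_def id_functor_def Ob_simplicial extensional_restrict)

lemma levelwise_ob_comp:
  "levelwise_ob (comp_functor G F) X = levelwise_ob G (levelwise_ob F X)"
  by (auto simp: levelwise_ob_def comp_functor_def restrict_def)

lemma levelwise_ob_level [simp]: "FOb (levelwise_ob T X) n = FOb T (FOb X n)"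
  by (simp add: levelwise_ob_def)

lemma levelwise_ob_arrow:
  "\<theta> \<in> Hom simplex_cat m n \<Longrightarrow> FAr (levelwise_ob T X) \<theta> = FAr T (FAr X \<theta>)"
  by (auto simp: levelwise_ob_def in_Hom_iff)

lemma levelwise_sel [simp]:
  "FOb (levelwise T) = levelwise_ob T"
  "FAr (levelwise T) f = Arrow (levelwise_ob T (src f)) (levelwise_ob T (tgt f)) (\<lambda>n. FAr T (fn f n))"
  by (auto simp: levelwise_def)

lemma levelwise_ob_simplicial:
  assumes T: "is_functor C D T" and X: "X \<in> Ob (simplicial C)"
  shows "levelwise_ob T X \<in> Ob (simplicial D)"
proof -
  have "is_functor (opposite simplex_cat) D (comp_functor T X)"
    using X T by (auto simp: Ob_simplicial intro: is_functor_comp)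
  then interpret TX: is_functor "opposite simplex_cat" D "comp_functor T X" .
  interpret S: category simplex_cat by (rule category_simplex_cat)
  \<comment> \<open>Off the arrows of the simplex category the two sides may differ; the functor
    laws mention only actual arrows and so carry over from the composite.\<close>
  have eq: "FAr (levelwise_ob T X) \<theta> = FAr (comp_functor T X) \<theta>" if "\<theta> \<in> Hom simplex_cat m n" for \<theta> m n
    by (simp add: comp_functor_def levelwise_ob_arrow[OF that])
  have ob: "FOb (levelwise_ob T X) = FOb (comp_functor T X)"
    by (auto simp: comp_functor_def)
  have "is_functor (opposite simplex_cat) D (levelwise_ob T X)"
  proof (rule is_functorI)
    fix \<theta> m n assume "\<theta> \<in> Hom (opposite simplex_cat) m n"
    then show "FAr (levelwise_ob T X) \<theta> \<in> Hom D (FOb (levelwise_ob T X) m) (FOb (levelwise_ob T X) n)"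
      using TX.ar[of \<theta> m n] by (simp add: ob eq[of \<theta> n m])
  next
    fix n assume "n \<in> Ob (opposite simplex_cat)"
    then show "FAr (levelwise_ob T X) (Ide (opposite simplex_cat) n) = Ide D (FOb (levelwise_ob T X) n)"
      using TX.fun_ide[of n] eq[OF S.ide[of n]] by (simp add: ob)
  next
    fix \<theta> \<phi> k m n
    assume "\<theta> \<in> Hom (opposite simplex_cat) k m" "\<phi> \<in> Hom (opposite simplex_cat) m n"
    then show "FAr (levelwise_ob T X) (Cmp (opposite simplex_cat) \<phi> \<theta>) =
        Cmp D (FAr (levelwise_ob T X) \<phi>) (FAr (levelwise_ob T X) \<theta>)"
      using TX.fun_cmp[of \<theta> k m \<phi> n] eq[OF S.cmp[of \<phi> n m \<theta> k]] eq[of \<theta> m k] eq[of \<phi> n m]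
      by simp
  qed (use TX.ob in \<open>simp_all add: ob TX.source.category_axioms TX.target.category_axioms\<close>)
  then show ?thesis
    by (simp add: Ob_simplicial) (simp add: levelwise_ob_def)
qed

lemma is_functor_levelwise:
  assumes "is_functor C D T"
  shows "is_functor (simplicial C) (simplicial D) (levelwise T)"
proof -
  interpret T: is_functor C D T by fact
  show ?thesis
  proof (rule is_functorI)
    fix f X Y assume f: "f \<in> Hom (simplicial C) X Y"
    then have X: "X \<in> Ob (simplicial C)" and Y: "Y \<in> Ob (simplicial C)"
      and [simp]: "src f = X" "tgt f = Y"
      by (auto simp: Hom_simplicial)
    show "FAr (levelwise T) f \<in> Hom (simplicial D) (FOb (levelwise T) X) (FOb (levelwise T) Y)"
      unfolding levelwise_sel \<open>src f = X\<close> \<open>tgt f = Y\<close>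
    proof (rule simplicial_mapI)
      fix \<theta> m n assume \<theta>: "\<theta> \<in> Hom simplex_cat m n"
      note fX = simplicial_map_level[OF f] and aX = simplicial_ob_arrow[OF X \<theta>] and aY = simplicial_ob_arrow[OF Y \<theta>]
      show "Cmp D (FAr T (fn f m)) (FAr (levelwise_ob T X) \<theta>) = Cmp D (FAr (levelwise_ob T Y) \<theta>) (FAr T (fn f n))"
        using simplicial_map_natural[OF f \<theta>]
        by (simp add: levelwise_ob_arrow[OF \<theta>] T.fun_cmp[OF aX fX, symmetric] T.fun_cmp[OF fX aY, symmetric])
    qed (auto simp: levelwise_ob_simplicial[OF assms] X Y intro: T.ar simplicial_map_level[OF f])
  next
    fix f g X Y Z assume f: "f \<in> Hom (simplicial C) X Y" and g: "g \<in> Hom (simplicial C) Y Z"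
    show "FAr (levelwise T) (Cmp (simplicial C) g f) =
      Cmp (simplicial D) (FAr (levelwise T) g) (FAr (levelwise T) f)"
      by (simp add: T.fun_cmp[OF simplicial_map_level[OF f] simplicial_map_level[OF g]])
  qed (auto simp: category_simplicial T.source.category_axioms T.target.category_axioms
      levelwise_ob_simplicial[OF assms] T.fun_ide simplicial_ob_level)
qed

lemma levelwise_trans_Hom:
  assumes "nat_trans C D S T t" "X \<in> Ob (simplicial C)"
  shows "levelwise_trans S T t X \<in> Hom (simplicial D) (levelwise_ob S X) (levelwise_ob T X)"
proof -
  interpret t: nat_trans C D S T t by fact
  show ?thesis
    unfolding levelwise_trans_def
  proof (rule simplicial_mapI)
    fix \<theta> m n assume \<theta>: "\<theta> \<in> Hom simplex_cat m n"
    show "Cmp D (t (FOb X m)) (FAr (levelwise_ob S X) \<theta>) = Cmp D (FAr (levelwise_ob T X) \<theta>) (t (FOb X n))"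
      unfolding levelwise_ob_arrow[OF \<theta>]
      by (rule t.naturality[OF simplicial_ob_arrow[OF assms(2) \<theta>]])
  qed (auto simp: levelwise_ob_simplicial[OF t.source.is_functor_axioms]
        levelwise_ob_simplicial[OF t.target.is_functor_axioms] assms simplicial_ob_level
      intro: t.component)
qed

text \<open>The levelwise unit and counit have sources and targets such as
  \<open>levelwise_ob id_functor X\<close> and \<open>levelwise_ob (comp_functor R L) X\<close>.
  These are strictly equal to X and to the twofold application of \<open>levelwise_ob\<close>, after
  which each law is the given one in every degree.\<close>

lemma adjunction_levelwise:
  assumes "adjunction C D L R unt cnt"
  shows "adjunction (simplicial C) (simplicial D) (levelwise L) (levelwise R)
    (levelwise_trans id_functor (comp_functor R L) unt)
    (levelwise_trans (comp_functor L R) id_functor cnt)"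
proof -
  interpret adjunction C D L R unt cnt by fact
  interpret unt: nat_trans C C id_functor "comp_functor R L" unt by (rule unit_nat)
  interpret cnt: nat_trans D D "comp_functor L R" id_functor cnt by (rule counit_nat)
  note L = is_functor_levelwise[OF left_functor] and R = is_functor_levelwise[OF right_functor]
  note catC = unt.source.source.category_axioms and catD = cnt.source.source.category_axioms
  have FOb_id [simp]: "FOb id_functor X = X" "FAr id_functor f = f" for X f
    by (simp_all add: id_functor_def)
  have comp_sel [simp]: "FOb (comp_functor G F) X = FOb G (FOb F X)"
    "FAr (comp_functor G F) f = FAr G (FAr F f)" for G F X f
    by (simp_all add: comp_functor_def)
  show ?thesis
  proof (rule adjunction.intro)
    show "nat_trans (simplicial C) (simplicial C) id_functor (comp_functor (levelwise R) (levelwise L))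
        (levelwise_trans id_functor (comp_functor R L) unt)"
    proof (rule nat_transI)
      fix X assume "X \<in> Ob (simplicial C)"
      with levelwise_trans_Hom[OF unit_nat this]
      show "levelwise_trans id_functor (comp_functor R L) unt X
          \<in> Hom (simplicial C) (FOb id_functor X) (FOb (comp_functor (levelwise R) (levelwise L)) X)"
        by (simp add: levelwise_ob_id levelwise_ob_comp)
    next
      fix f X Y assume f: "f \<in> Hom (simplicial C) X Y"
      show "Cmp (simplicial C) (levelwise_trans id_functor (comp_functor R L) unt Y) (FAr id_functor f) =
        Cmp (simplicial C) (FAr (comp_functor (levelwise R) (levelwise L)) f)
          (levelwise_trans id_functor (comp_functor R L) unt X)"
        using f unt.naturality[OF simplicial_map_level[OF f]]
        by (auto simp: levelwise_trans_def levelwise_ob_id levelwise_ob_comp Hom_simplicial)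
    qed (rule is_functor_id category_simplicial catC is_functor_comp L R)+
    show "nat_trans (simplicial D) (simplicial D) (comp_functor (levelwise L) (levelwise R)) id_functor
        (levelwise_trans (comp_functor L R) id_functor cnt)"
    proof (rule nat_transI)
      fix X assume "X \<in> Ob (simplicial D)"
      with levelwise_trans_Hom[OF counit_nat this]
      show "levelwise_trans (comp_functor L R) id_functor cnt X
          \<in> Hom (simplicial D) (FOb (comp_functor (levelwise L) (levelwise R)) X) (FOb id_functor X)"
        by (simp add: levelwise_ob_id levelwise_ob_comp)
    next
      fix f X Y assume f: "f \<in> Hom (simplicial D) X Y"
      show "Cmp (simplicial D) (levelwise_trans (comp_functor L R) id_functor cnt Y)
          (FAr (comp_functor (levelwise L) (levelwise R)) f) =
        Cmp (simplicial D) (FAr id_functor f) (levelwise_trans (comp_functor L R) id_functor cnt X)"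
        using f cnt.naturality[OF simplicial_map_level[OF f]]
        by (auto simp: levelwise_trans_def levelwise_ob_id levelwise_ob_comp Hom_simplicial)
    qed (rule is_functor_id category_simplicial catD is_functor_comp L R)+
  qed (auto simp: L R levelwise_trans_def levelwise_ob_id levelwise_ob_comp
      triangle_left triangle_right simplicial_ob_level levelwise_ob_id[OF levelwise_ob_simplicial[OF left_functor]]
      levelwise_ob_id[OF levelwise_ob_simplicial[OF right_functor]])
qed

section \<open>Isomorphisms of simplicial objects, detected in each degree\<close>

lemma isomorphismI:
  assumes "f \<in> Hom C X Y" "g \<in> Hom C Y X" "Cmp C g f = Ide C X" "Cmp C f g = Ide C Y"
  shows "isomorphism C f"
  using assms by (auto simp: isomorphism_def Hom_def)

lemma isomorphismE:
  assumes "isomorphism C f" "f \<in> Hom C X Y"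
  obtains g where "g \<in> Hom C Y X" "Cmp C g f = Ide C X" "Cmp C f g = Ide C Y"
  using assms by (auto simp: isomorphism_def Hom_def)

lemma isomorphism_simplicial:
  assumes D: "category D" and f: "f \<in> Hom (simplicial D) X Y"
    and iso: "\<And>n. isomorphism D (fn f n)"
  shows "isomorphism (simplicial D) f"
proof -
  interpret D: category D by fact
  have X: "X \<in> Ob (simplicial D)" and Y: "Y \<in> Ob (simplicial D)"
    and [simp]: "src f = X" "tgt f = Y"
    using f by (auto simp: Hom_simplicial)
  note fl = simplicial_map_level[OF f]
  have "\<forall>n. \<exists>g. g \<in> Hom D (FOb Y n) (FOb X n) \<and>
      Cmp D g (fn f n) = Ide D (FOb X n) \<and> Cmp D (fn f n) g = Ide D (FOb Y n)"
    using isomorphismE[OF iso fl] by metis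
  then obtain g where g: "\<And>n. g n \<in> Hom D (FOb Y n) (FOb X n)"
      "\<And>n. Cmp D (g n) (fn f n) = Ide D (FOb X n)" "\<And>n. Cmp D (fn f n) (g n) = Ide D (FOb Y n)"
    by metis
  have "Arrow Y X g \<in> Hom (simplicial D) Y X"
  proof (rule simplicial_mapI)
    fix \<theta> m n assume \<theta>: "\<theta> \<in> Hom simplex_cat m n"
    note aX = simplicial_ob_arrow[OF X \<theta>] and aY = simplicial_ob_arrow[OF Y \<theta>]
    \<comment> \<open>Naturality of the inverses is forced: insert f g = 1 on the right, move f
      across its own naturality square, and cancel g f = 1 on the left.\<close>
    have "Cmp D (g m) (FAr Y \<theta>) = Cmp D (g m) (Cmp D (FAr Y \<theta>) (Cmp D (fn f n) (g n)))"
      by (simp add: g D.cmp_ide[OF aY])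
    also have "\<dots> = Cmp D (g m) (Cmp D (Cmp D (fn f m) (FAr X \<theta>)) (g n))"
      by (simp add: D.assoc[OF g(1) fl aY] simplicial_map_natural[OF f \<theta>])
    also have "\<dots> = Cmp D (g m) (Cmp D (fn f m) (Cmp D (FAr X \<theta>) (g n)))"
      by (simp add: D.assoc[OF g(1) aX fl])
    also have "\<dots> = Cmp D (FAr X \<theta>) (g n)"
      by (simp add: D.assoc[OF D.cmp[OF g(1) aX] fl g(1)] g(2) D.ide_cmp[OF D.cmp[OF g(1) aX]])
    finally show "Cmp D (g m) (FAr Y \<theta>) = Cmp D (FAr X \<theta>) (g n)" .
  qed (auto simp: X Y g)
  then show ?thesis
    by (rule isomorphismI[OF f]) (simp_all add: g)
qed

section \<open>The comparison adjunction of a comonad\<close>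

lemma coalg_cat_sel [simp]:
  "Dom (coalg_cat D K) = src" "Cod (coalg_cat D K) = tgt"
  "Ide (coalg_cat D K) P = Arrow P P (Ide D (fst P))"
  "Cmp (coalg_cat D K) g f = Arrow (src f) (tgt g) (Cmp D (fn g) (fn f))"
  by (simp_all add: coalg_cat_def split: prod.split)

lemma Ob_coalg_cat: "P \<in> Ob (coalg_cat D K) \<longleftrightarrow> coalgebra D K (fst P) (snd P)"
  by (auto simp: coalg_cat_def)

lemma Hom_coalg_cat:
  "f \<in> Hom (coalg_cat D K) P Q \<longleftrightarrow>
    P \<in> Ob (coalg_cat D K) \<and> Q \<in> Ob (coalg_cat D K) \<and> src f = P \<and> tgt f = Q \<and>
    fn f \<in> Hom D (fst P) (fst Q) \<and>
    Cmp D (snd Q) (fn f) = Cmp D (FAr (Endo K) (fn f)) (snd P)"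
  by (cases f; cases P; cases Q) (auto simp: coalg_cat_def Hom_def[of "coalg_cat D K"] Hom_def)

lemma category_coalg_cat:
  assumes "is_functor D D (Endo K)"
  shows "category (coalg_cat D K)"
proof -
  interpret K: is_functor D D "Endo K" by fact
  note assoc = K.source.assoc
  show ?thesis
  proof (rule category.intro)
    fix f assume "f \<in> Ar (coalg_cat D K)"
    then have "f \<in> Hom (coalg_cat D K) (src f) (tgt f)" by (simp add: in_Hom_iff)
    then show "Dom (coalg_cat D K) f \<in> Ob (coalg_cat D K) \<and> Cod (coalg_cat D K) f \<in> Ob (coalg_cat D K)"
      by (simp add: Hom_coalg_cat)
  next
    fix P assume "P \<in> Ob (coalg_cat D K)"
    then have "coalgebra D K (fst P) (snd P)" by (simp add: Ob_coalg_cat)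
    then have "fst P \<in> Ob D" "snd P \<in> Hom D (fst P) (FOb (Endo K) (fst P))"
      by (auto simp: coalgebra_def)
    with \<open>P \<in> Ob (coalg_cat D K)\<close>
    show "Ide (coalg_cat D K) P \<in> Hom (coalg_cat D K) P P"
      by (simp add: Hom_coalg_cat K.source.ide K.fun_ide K.source.cmp_ide K.source.ide_cmp)
  next
    fix f g P Q S
    assume f: "f \<in> Hom (coalg_cat D K) P Q" and g: "g \<in> Hom (coalg_cat D K) Q S"
    have f': "fn f \<in> Hom D (fst P) (fst Q)" and g': "fn g \<in> Hom D (fst Q) (fst S)"
      and P: "snd P \<in> Hom D (fst P) (FOb (Endo K) (fst P))"
      and Q: "snd Q \<in> Hom D (fst Q) (FOb (Endo K) (fst Q))"
      and S: "snd S \<in> Hom D (fst S) (FOb (Endo K) (fst S))"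
      and cf: "Cmp D (snd Q) (fn f) = Cmp D (FAr (Endo K) (fn f)) (snd P)"
      and cg: "Cmp D (snd S) (fn g) = Cmp D (FAr (Endo K) (fn g)) (snd Q)"
      using f g by (auto simp: Hom_coalg_cat Ob_coalg_cat coalgebra_def)
    have "Cmp D (snd S) (Cmp D (fn g) (fn f)) = Cmp D (FAr (Endo K) (fn g)) (Cmp D (snd Q) (fn f))"
      by (simp add: assoc[OF f' g' S] assoc[OF f' Q K.ar[OF g']] cg)
    also have "\<dots> = Cmp D (FAr (Endo K) (Cmp D (fn g) (fn f))) (snd P)"
      by (simp add: cf K.fun_cmp[OF f' g'] assoc[OF P K.ar[OF f'] K.ar[OF g']])
    finally show "Cmp (coalg_cat D K) g f \<in> Hom (coalg_cat D K) P S"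
      using f g K.source.cmp[OF f' g'] by (simp add: Hom_coalg_cat)
  next
    fix f P Q assume "f \<in> Hom (coalg_cat D K) P Q"
    then have [simp]: "src f = P" "tgt f = Q" and f: "fn f \<in> Hom D (fst P) (fst Q)"
      by (auto simp: Hom_coalg_cat)
    show "Cmp (coalg_cat D K) f (Ide (coalg_cat D K) P) = f"
      "Cmp (coalg_cat D K) (Ide (coalg_cat D K) Q) f = f"
      by (simp_all add: K.source.cmp_ide[OF f] K.source.ide_cmp[OF f] arrow.expand)
  next
    fix f g h W X Y Z
    assume "f \<in> Hom (coalg_cat D K) W X" "g \<in> Hom (coalg_cat D K) X Y" "h \<in> Hom (coalg_cat D K) Y Z"
    then have "fn f \<in> Hom D (fst W) (fst X)" "fn g \<in> Hom D (fst X) (fst Y)" "fn h \<in> Hom D (fst Y) (fst Z)"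
      by (auto simp: Hom_coalg_cat)
    from assoc[OF this]
    show "Cmp (coalg_cat D K) h (Cmp (coalg_cat D K) g f) =
      Cmp (coalg_cat D K) (Cmp (coalg_cat D K) h g) f"
      by simp
  qed
qed

text \<open>The forgetful functor to D reflects isomorphisms. Composing the coaction square of f
  with its inverse g on both sides, and using that \<open>Endo K\<close> preserves g f = 1, gives
  the square for g.\<close>

lemma isomorphism_coalg_cat:
  assumes K: "is_functor D D (Endo K)" and f: "f \<in> Hom (coalg_cat D K) P Q"
    and iso: "isomorphism D (fn f)"
  shows "isomorphism (coalg_cat D K) f"
proof -
  interpret K: is_functor D D "Endo K" by fact
  note assoc = K.source.assoc
  have P: "P \<in> Ob (coalg_cat D K)" and Q: "Q \<in> Ob (coalg_cat D K)" and [simp]: "src f = P" "tgt f = Q"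
    and f': "fn f \<in> Hom D (fst P) (fst Q)"
    and cf: "Cmp D (snd Q) (fn f) = Cmp D (FAr (Endo K) (fn f)) (snd P)"
    using f by (auto simp: Hom_coalg_cat)
  have p: "snd P \<in> Hom D (fst P) (FOb (Endo K) (fst P))"
    and q: "snd Q \<in> Hom D (fst Q) (FOb (Endo K) (fst Q))"
    using P Q by (auto simp: Ob_coalg_cat coalgebra_def)
  obtain g where g: "g \<in> Hom D (fst Q) (fst P)" and gf: "Cmp D g (fn f) = Ide D (fst P)"
    and fg: "Cmp D (fn f) g = Ide D (fst Q)"
    using isomorphismE[OF iso f'] .
  note Kg = K.ar[OF g] and Kf = K.ar[OF f']
  have "Cmp D (FAr (Endo K) g) (snd Q) = Cmp D (FAr (Endo K) g) (Cmp D (Cmp D (snd Q) (fn f)) g)"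
    by (simp add: assoc[OF g f' q, symmetric] fg K.source.cmp_ide[OF q])
  also have "\<dots> = Cmp D (FAr (Endo K) g) (Cmp D (FAr (Endo K) (fn f)) (Cmp D (snd P) g))"
    by (simp add: cf assoc[OF g p Kf])
  also have "\<dots> = Cmp D (FAr (Endo K) (Cmp D g (fn f))) (Cmp D (snd P) g)"
    by (simp add: assoc[OF K.source.cmp[OF g p] Kf Kg] K.fun_cmp[OF f' g])
  also have "\<dots> = Cmp D (snd P) g"
    using Hom_Ob[OF K.source.category_axioms g]
    by (simp add: gf K.fun_ide K.source.ide_cmp[OF K.source.cmp[OF g p]])
  finally have "Arrow Q P g \<in> Hom (coalg_cat D K) Q P"
    by (simp add: Hom_coalg_cat P Q g)
  then show ?thesis
    by (rule isomorphismI[OF f]) (simp_all add: gf fg)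
qed

section \<open>The comparison functor of an arbitrary adjunction\<close>

context adjunction
begin

abbreviation "K \<equiv> adjunction_comonad L R unt cnt"
abbreviation "E \<equiv> coalg_cat D K"
abbreviation "Cn \<equiv> comparison C L unt"

sublocale L: is_functor C D L by (rule left_functor)
sublocale R: is_functor D C R by (rule right_functor)
sublocale unt: nat_trans C C id_functor "comp_functor R L" unt by (rule unit_nat)
sublocale cnt: nat_trans D D "comp_functor L R" id_functor cnt by (rule counit_nat)

lemmas catC = L.source.category_axioms and catD = L.target.category_axioms

lemma K_sel [simp]:
  "FOb (Endo K) A = FOb L (FOb R A)" "FAr (Endo K) f = FAr L (FAr R f)"
  "Comult K A = FAr L (unt (FOb R A))" "Counit K = cnt"
  by (simp_all add: adjunction_comonad_def comp_functor_def)

lemma K_functor: "is_functor D D (Endo K)"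
  by (simp add: adjunction_comonad_def is_functor_comp[OF right_functor left_functor])

lemma catE: "category E"
  by (rule category_coalg_cat[OF K_functor])

lemma comparison_sel [simp]:
  "FOb Cn X = (FOb L X, FAr L (unt X))"
  "FAr Cn f = Arrow (FOb L (Dom C f), FAr L (unt (Dom C f))) (FOb L (Cod C f), FAr L (unt (Cod C f))) (FAr L f)"
  by (simp_all add: comparison_def)

lemma unt_Hom: "X \<in> Ob C \<Longrightarrow> unt X \<in> Hom C X (FOb R (FOb L X))"
  using unt.component by (simp add: id_functor_def comp_functor_def)

lemma cnt_Hom: "A \<in> Ob D \<Longrightarrow> cnt A \<in> Hom D (FOb L (FOb R A)) A"
  using cnt.component by (simp add: id_functor_def comp_functor_def)

lemma unt_nat: "f \<in> Hom C X Y \<Longrightarrow> Cmp C (FAr R (FAr L f)) (unt X) = Cmp C (unt Y) f"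
  using unt.naturality[of f X Y] by (simp add: id_functor_def comp_functor_def)

lemma cnt_nat: "f \<in> Hom D A B \<Longrightarrow> Cmp D (cnt B) (FAr L (FAr R f)) = Cmp D f (cnt A)"
  using cnt.naturality[of f A B] by (simp add: id_functor_def comp_functor_def)

text \<open>The counit law is a triangle identity. Coassociativity is L applied to the naturality
  square of the unit at the arrow \<open>unt X\<close> itself.\<close>

lemma comparison_Ob:
  assumes X: "X \<in> Ob C"
  shows "(FOb L X, FAr L (unt X)) \<in> Ob E"
proof -
  note u = unt_Hom[OF X]
  have RLX: "FOb R (FOb L X) \<in> Ob C" by (simp add: X L.ob R.ob)
  have "Cmp D (FAr L (FAr R (FAr L (unt X)))) (FAr L (unt X)) =
    Cmp D (FAr L (unt (FOb R (FOb L X)))) (FAr L (unt X))"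
    by (simp add: L.fun_cmp[OF u R.ar[OF L.ar[OF u]], symmetric]
        L.fun_cmp[OF u unt_Hom[OF RLX], symmetric] unt_nat[OF u])
  then show ?thesis
    by (simp add: Ob_coalg_cat coalgebra_def L.ob X L.ar[OF u] triangle_left)
qed

lemma comparison_functor: "is_functor C E Cn"
proof (rule is_functorI)
  fix f X Y assume f: "f \<in> Hom C X Y"
  then have X: "X \<in> Ob C" and Y: "Y \<in> Ob C" and [simp]: "Dom C f = X" "Cod C f = Y"
    using Hom_Ob[OF catC f] by (auto simp: Hom_def)
  have "Cmp D (FAr L (unt Y)) (FAr L f) = Cmp D (FAr L (FAr R (FAr L f))) (FAr L (unt X))"
    by (simp add: L.fun_cmp[OF f unt_Hom[OF Y], symmetric]
        L.fun_cmp[OF unt_Hom[OF X] R.ar[OF L.ar[OF f]], symmetric] unt_nat[OF f])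
  then show "FAr Cn f \<in> Hom E (FOb Cn X) (FOb Cn Y)"
    by (simp add: Hom_coalg_cat comparison_Ob X Y L.ar[OF f])
next
  fix f g X Y Z assume f: "f \<in> Hom C X Y" and g: "g \<in> Hom C Y Z"
  then show "FAr Cn (Cmp C g f) = Cmp E (FAr Cn g) (FAr Cn f)"
    using L.source.cmp[OF f g] by (auto simp: L.fun_cmp[OF f g] in_Hom_iff)
next
  fix X assume "X \<in> Ob C"
  then show "FAr Cn (Ide C X) = Ide E (FOb Cn X)"
    using L.source.ide[of X] by (simp add: L.fun_ide in_Hom_iff)
qed (simp_all add: catC catE comparison_Ob)

lemma Ob_E_D: "P \<in> Ob E \<Longrightarrow> fst P \<in> Ob D"
  "P \<in> Ob E \<Longrightarrow> snd P \<in> Hom D (fst P) (FOb L (FOb R (fst P)))"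
  by (auto simp: Ob_coalg_cat coalgebra_def)

lemma Hom_E_D:
  "f \<in> Hom E P Q \<Longrightarrow> P \<in> Ob E" "f \<in> Hom E P Q \<Longrightarrow> Q \<in> Ob E"
  "f \<in> Hom E P Q \<Longrightarrow> fn f \<in> Hom D (fst P) (fst Q)"
  by (auto simp: Hom_coalg_cat)

end

text \<open>Naturality, functoriality of \<open>V\<close> and one triangle identity follow by cancelling the monic \<open>incl\<close>.\<close>

locale comparison_adjunction = adjunction C D L R unt cnt
  for C :: "('o, 'a) cat" and D :: "('p, 'b) cat"
    and L :: "('o, 'a, 'p, 'b) functr" and R :: "('p, 'b, 'o, 'a) functr"
    and unt :: "'o \<Rightarrow> 'a" and cnt :: "'p \<Rightarrow> 'b" +
  fixes V :: "('p \<times> 'b, ('p \<times> 'b, 'b) arrow, 'o, 'a) functr"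
    and incl :: "'p \<times> 'b \<Rightarrow> 'a" and u :: "'o \<Rightarrow> 'a"
  assumes incl: "P \<in> Ob E \<Longrightarrow>
      incl P \<in> Hom C (FOb V P) (FOb R (fst P))"
    and equalizes: "P \<in> Ob E \<Longrightarrow>
      Cmp C (FAr R (snd P)) (incl P) = Cmp C (unt (FOb R (fst P))) (incl P)"
    and monic: "\<lbrakk>P \<in> Ob E;
      h \<in> Hom C X (FOb V P); k \<in> Hom C X (FOb V P); Cmp C (incl P) h = Cmp C (incl P) k\<rbrakk> \<Longrightarrow> h = k"
    and V_Hom: "f \<in> Hom E P Q \<Longrightarrow>
      FAr V f \<in> Hom C (FOb V P) (FOb V Q)"
    and incl_V: "f \<in> Hom E P Q \<Longrightarrow>
      Cmp C (incl Q) (FAr V f) = Cmp C (FAr R (fn f)) (incl P)"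
    and u_Hom: "X \<in> Ob C \<Longrightarrow> u X \<in> Hom C X (FOb V (FOb L X, FAr L (unt X)))"
    and incl_u: "X \<in> Ob C \<Longrightarrow> Cmp C (incl (FOb L X, FAr L (unt X))) (u X) = unt X"
begin

abbreviation "counit \<equiv> \<lambda>P. Arrow (FOb Cn (FOb V P)) P (Cmp D (cnt (fst P)) (FAr L (incl P)))"

lemma V_ob: "P \<in> Ob E \<Longrightarrow> FOb V P \<in> Ob C"
  using Hom_Ob[OF catC incl] by blast

lemma right_adjoint_functor: "is_functor E C V"
proof (rule is_functorI)
  fix P assume P: "P \<in> Ob E"
  show "FAr V (Ide E P) = Ide C (FOb V P)"
  proof (rule monic[OF P])
    have i: "Ide E P \<in> Hom E P P" using P catE by (rule category.ide[rotated])
    show "FAr V (Ide E P) \<in> Hom C (FOb V P) (FOb V P)"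
      by (rule V_Hom[OF i])
    show "Ide C (FOb V P) \<in> Hom C (FOb V P) (FOb V P)"
      by (rule L.source.ide[OF V_ob[OF P]])
    show "Cmp C (incl P) (FAr V (Ide E P)) = Cmp C (incl P) (Ide C (FOb V P))"
      by (simp only: incl_V[OF i])
        (simp add: R.fun_ide Ob_E_D P L.source.ide_cmp[OF incl[OF P]] L.source.cmp_ide[OF incl[OF P]])
  qed
next
  fix f g P Q S assume f: "f \<in> Hom E P Q" and g: "g \<in> Hom E Q S"
  note P = Hom_E_D(1)[OF f] and Q = Hom_E_D(2)[OF f] and S = Hom_E_D(2)[OF g]
  note f' = Hom_E_D(3)[OF f] and g' = Hom_E_D(3)[OF g]
  note gf = category.cmp[OF catE f g]
  note assoc = L.source.assoc
  show "FAr V (Cmp E g f) = Cmp C (FAr V g) (FAr V f)"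
  proof (rule monic[OF S V_Hom[OF gf] L.source.cmp[OF V_Hom[OF f] V_Hom[OF g]]])
    have "Cmp C (incl S) (FAr V (Cmp E g f)) = Cmp C (Cmp C (FAr R (fn g)) (FAr R (fn f))) (incl P)"
      by (simp only: incl_V[OF gf]) (simp add: R.fun_cmp[OF f' g'])
    also have "\<dots> = Cmp C (incl S) (Cmp C (FAr V g) (FAr V f))"
      by (simp add: assoc[OF incl[OF P] R.ar[OF f'] R.ar[OF g'], symmetric] incl_V[OF f, symmetric]
          assoc[OF V_Hom[OF f] incl[OF Q] R.ar[OF g']] incl_V[OF g, symmetric]
          assoc[OF V_Hom[OF f] V_Hom[OF g] incl[OF S]])
    finally show "Cmp C (incl S) (FAr V (Cmp E g f)) = Cmp C (incl S) (Cmp C (FAr V g) (FAr V f))" .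
  qed
qed (simp_all add: catC catE V_ob V_Hom)

text \<open>The comparison counit is the adjunct of \<open>incl P\<close>, so transposing it back
  returns \<open>incl P\<close>. This serves both for the coaction square of the counit and for the
  triangle identity on the side of V.\<close>

lemma R_counit_unt:
  assumes P: "P \<in> Ob E"
  shows "Cmp C (FAr R (fn (counit P))) (unt (FOb V P)) = incl P"
proof -
  note i = incl[OF P] and A = Ob_E_D(1)[OF P]
  note RA = R.ob[OF A] and cA = cnt_Hom[OF A] and Li = L.ar[OF i] and uV = unt_Hom[OF V_ob[OF P]]
  have "Cmp C (FAr R (Cmp D (cnt (fst P)) (FAr L (incl P)))) (unt (FOb V P)) =
      Cmp C (FAr R (cnt (fst P))) (Cmp C (unt (FOb R (fst P))) (incl P))"
    by (simp add: R.fun_cmp[OF Li cA] L.source.assoc[OF uV R.ar[OF Li] R.ar[OF cA], symmetric] unt_nat[OF i])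
  also have "\<dots> = incl P"
    by (simp add: L.source.assoc[OF i unt_Hom[OF RA] R.ar[OF cA]] triangle_right A L.source.ide_cmp[OF i])
  finally show ?thesis by simp
qed

lemma counit_Hom:
  assumes P: "P \<in> Ob E"
  shows "counit P \<in> Hom E (FOb Cn (FOb V P)) P"
proof -
  note i = incl[OF P] and A = Ob_E_D(1)[OF P] and d = Ob_E_D(2)[OF P]
  note RA = R.ob[OF A]
  note cA = cnt_Hom[OF A] and Li = L.ar[OF i] and uV = unt_Hom[OF V_ob[OF P]]
  note c = L.target.cmp[OF Li cA]
  \<comment> \<open>Both legs of the coaction square equal \<open>FAr L (incl P)\<close>. In this
    one, naturality of \<open>cnt\<close> brings the coaction next to \<open>incl P\<close>, the
    equalizer property replaces it by the unit, and a triangle identity cancels the rest.\<close>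
  have "Cmp D (snd P) (Cmp D (cnt (fst P)) (FAr L (incl P))) =
      Cmp D (cnt (FOb L (FOb R (fst P)))) (Cmp D (FAr L (FAr R (snd P))) (FAr L (incl P)))"
    by (simp add: L.target.assoc[OF Li cA d] cnt_nat[OF d, symmetric]
        L.target.assoc[OF Li L.ar[OF R.ar[OF d]] cnt_Hom[OF L.ob[OF RA]]])
  also have "\<dots> = Cmp D (cnt (FOb L (FOb R (fst P)))) (Cmp D (FAr L (unt (FOb R (fst P)))) (FAr L (incl P)))"
    by (simp add: L.fun_cmp[OF i R.ar[OF d], symmetric] L.fun_cmp[OF i unt_Hom[OF RA], symmetric]
        equalizes[OF P])
  also have "\<dots> = FAr L (incl P)"
    by (simp add: L.target.assoc[OF Li L.ar[OF unt_Hom[OF RA]] cnt_Hom[OF L.ob[OF RA]]]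
        triangle_left RA L.target.ide_cmp[OF Li])
  finally have 1: "Cmp D (snd P) (Cmp D (cnt (fst P)) (FAr L (incl P))) = FAr L (incl P)" .
  \<comment> \<open>For the other leg, L of this equation is all that is needed.\<close>
  have 2: "Cmp C (FAr R (Cmp D (cnt (fst P)) (FAr L (incl P)))) (unt (FOb V P)) = incl P"
    using R_counit_unt[OF P] by simp
  show ?thesis
    using c by (simp add: Hom_coalg_cat P comparison_Ob V_ob 1
        L.fun_cmp[OF uV R.ar[OF c], symmetric] 2)
qed

lemma unit_natural: "nat_trans C C id_functor (comp_functor V Cn) u"
proof (rule nat_transI)
  fix f X Y assume f: "f \<in> Hom C X Y"
  have X: "X \<in> Ob C" and Y: "Y \<in> Ob C" using Hom_Ob[OF catC f] by auto
  define P where "P = FOb Cn X"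
  define Q where "Q = FOb Cn Y"
  have P: "P \<in> Ob E" and Q: "Q \<in> Ob E" using X Y by (simp_all add: P_def Q_def comparison_Ob)
  have uX: "u X \<in> Hom C X (FOb V P)" and uY: "u Y \<in> Hom C Y (FOb V Q)"
    using X Y u_Hom by (simp_all add: P_def Q_def)
  have Cf: "FAr Cn f \<in> Hom E P Q"
    unfolding P_def Q_def by (rule is_functor.ar[OF comparison_functor f])
  have iu: "Cmp C (incl P) (u X) = unt X" "Cmp C (incl Q) (u Y) = unt Y"
    using X Y incl_u by (simp_all add: P_def Q_def)
  note RLf = R.ar[OF Hom_E_D(3)[OF Cf]]
  have "Cmp C (u Y) f = Cmp C (FAr V (FAr Cn f)) (u X)"
  proof (rule monic[OF Q L.source.cmp[OF f uY] L.source.cmp[OF uX V_Hom[OF Cf]]])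
    have "Cmp C (incl Q) (Cmp C (FAr V (FAr Cn f)) (u X)) = Cmp C (FAr R (fn (FAr Cn f))) (unt X)"
      by (simp only: L.source.assoc[OF uX V_Hom[OF Cf] incl[OF Q]] incl_V[OF Cf]
          L.source.assoc[OF uX incl[OF P] RLf, symmetric] iu)
    also have "\<dots> = Cmp C (incl Q) (Cmp C (u Y) f)"
      by (simp add: L.source.assoc[OF f uY incl[OF Q]] iu unt_nat[OF f])
    finally show "Cmp C (incl Q) (Cmp C (u Y) f) = Cmp C (incl Q) (Cmp C (FAr V (FAr Cn f)) (u X))" ..
  qed
  then show "Cmp C (u Y) (FAr id_functor f) = Cmp C (FAr (comp_functor V Cn) f) (u X)"
    by (simp add: id_functor_def comp_functor_def)
next
  fix X assume "X \<in> Ob C"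
  then show "u X \<in> Hom C (FOb id_functor X) (FOb (comp_functor V Cn) X)"
    using u_Hom by (simp add: id_functor_def comp_functor_def)
qed (rule is_functor_id catC is_functor_comp comparison_functor right_adjoint_functor)+

text \<open>Nothing is cancelled here: the square is naturality of \<open>cnt\<close> pasted with L
  applied to \<open>incl_V\<close>.\<close>

lemma counit_natural: "nat_trans E E (comp_functor Cn V) id_functor counit"
proof (rule nat_transI)
  fix f P Q assume f: "f \<in> Hom E P Q"
  note P = Hom_E_D(1)[OF f] and Q = Hom_E_D(2)[OF f] and f' = Hom_E_D(3)[OF f]
  note LVf = L.ar[OF V_Hom[OF f]] and LP = L.ar[OF incl[OF P]] and LQ = L.ar[OF incl[OF Q]]
  note cP = cnt_Hom[OF Ob_E_D(1)[OF P]] and cQ = cnt_Hom[OF Ob_E_D(1)[OF Q]]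
  have "Cmp D (Cmp D (cnt (fst Q)) (FAr L (incl Q))) (FAr L (FAr V f)) =
      Cmp D (cnt (fst Q)) (FAr L (Cmp C (FAr R (fn f)) (incl P)))"
    by (simp add: L.target.assoc[OF LVf LQ cQ, symmetric] L.fun_cmp[OF V_Hom[OF f] incl[OF Q], symmetric]
        incl_V[OF f])
  also have "\<dots> = Cmp D (fn f) (Cmp D (cnt (fst P)) (FAr L (incl P)))"
    by (simp add: L.fun_cmp[OF incl[OF P] R.ar[OF f']] L.target.assoc[OF LP L.ar[OF R.ar[OF f']] cQ]
        cnt_nat[OF f'] L.target.assoc[OF LP cP f'])
  finally show "Cmp E (counit Q) (FAr (comp_functor Cn V) f) = Cmp E (FAr id_functor f) (counit P)"
    using f V_Hom[OF f] by (simp add: id_functor_def comp_functor_def in_Hom_iff)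
next
  fix P assume "P \<in> Ob E"
  then show "counit P \<in> Hom E (FOb (comp_functor Cn V) P) (FOb id_functor P)"
    using counit_Hom by (simp add: id_functor_def comp_functor_def)
qed (rule is_functor_id catE is_functor_comp comparison_functor right_adjoint_functor)+

theorem comparison_is_adjunction: "adjunction C E Cn V u counit"
proof (rule adjunction.intro)
  fix X assume X: "X \<in> Ob C"
  define P where "P = FOb Cn X"
  have P: "P \<in> Ob E" using X by (simp add: P_def comparison_Ob)
  have uX: "u X \<in> Hom C X (FOb V P)" and iu: "Cmp C (incl P) (u X) = unt X"
    using X u_Hom incl_u by (simp_all add: P_def)
  have "fst P = FOb L X" by (simp add: P_def)
  \<comment> \<open>Since \<open>incl\<close> after \<open>u\<close> is the original unit, this
    triangle identity reduces to that of the given adjunction.\<close>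
  have "Cmp D (Cmp D (cnt (fst P)) (FAr L (incl P))) (FAr L (u X)) = Ide D (FOb L X)"
    by (simp add: L.target.assoc[OF L.ar[OF uX] L.ar[OF incl[OF P]] cnt_Hom[OF Ob_E_D(1)[OF P]], symmetric]
        L.fun_cmp[OF uX incl[OF P], symmetric] iu triangle_left X)
      (simp add: \<open>fst P = FOb L X\<close> triangle_left X)
  then show "Cmp E (counit (FOb Cn X)) (FAr Cn (u X)) = Ide E (FOb Cn X)"
    using uX by (simp add: P_def in_Hom_iff)
next
  fix P assume P: "P \<in> Ob E"
  let ?X = "FOb V P"
  have X: "?X \<in> Ob C" using P by (rule V_ob)
  have c: "counit P \<in> Hom E (FOb L ?X, FAr L (unt ?X)) P" using counit_Hom[OF P] by simp
  note uX = u_Hom[OF X] and Q = comparison_Ob[OF X]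
  show "Cmp C (FAr V (counit P)) (u ?X) = Ide C ?X"
  proof (rule monic[OF P L.source.cmp[OF uX V_Hom[OF c]] L.source.ide[OF X]])
    show "Cmp C (incl P) (Cmp C (FAr V (counit P)) (u ?X)) = Cmp C (incl P) (Ide C ?X)"
      by (simp only: L.source.assoc[OF uX V_Hom[OF c] incl[OF P]] incl_V[OF c]
          L.source.assoc[OF uX incl[OF Q] R.ar[OF Hom_E_D(3)[OF c]], symmetric] incl_u[OF X]
          R_counit_unt[OF P] L.source.cmp_ide[OF incl[OF P]])
  qed
qed (rule comparison_functor right_adjoint_functor unit_natural counit_natural)+

end

section \<open>Pointed sets and abelian groups\<close>

lemma Hom_pset:
  "f \<in> Hom pset_cat S T \<longleftrightarrow> src f = S \<and> tgt f = T \<and> base S \<in> points S \<and> base T \<in> points T \<and>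
    fn f \<in> points S \<rightarrow>\<^sub>E points T \<and> fn f (base S) = base T"
  by (cases f) (auto simp: pset_cat_def Hom_def)

lemma Hom_ab:
  "f \<in> Hom ab_cat A B \<longleftrightarrow> src f = A \<and> tgt f = B \<and> comm_group A \<and> comm_group B \<and>
    fn f \<in> hom A B \<and> fn f \<in> extensional (carrier A)"
  by (cases f) (auto simp: ab_cat_def Hom_def)

lemma pset_cat_sel [simp]:
  "S \<in> Ob pset_cat \<longleftrightarrow> base S \<in> points S" "Dom pset_cat = src" "Cod pset_cat = tgt"
  "Ide pset_cat S = Arrow S S (\<lambda>x\<in>points S. x)"
  "Cmp pset_cat g f = Arrow (src f) (tgt g) (compose (points (src f)) (fn g) (fn f))"
  by (simp_all add: pset_cat_def)

lemma ab_cat_sel [simp]: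
  "A \<in> Ob ab_cat \<longleftrightarrow> comm_group A" "Dom ab_cat = src" "Cod ab_cat = tgt"
  "Ide ab_cat A = Arrow A A (\<lambda>x\<in>carrier A. x)"
  "Cmp ab_cat g f = Arrow (src f) (tgt g) (compose (carrier (src f)) (fn g) (fn f))"
  by (simp_all add: ab_cat_def)

lemma pset_arrow_eqI:
  "f \<in> Hom pset_cat S T \<Longrightarrow> g \<in> Hom pset_cat S T \<Longrightarrow> (\<And>x. x \<in> points S \<Longrightarrow> fn f x = fn g x) \<Longrightarrow> f = g"
  by (cases f; cases g) (auto simp: Hom_pset intro: PiE_ext)

lemma ab_arrow_eqI:
  "f \<in> Hom ab_cat A B \<Longrightarrow> g \<in> Hom ab_cat A B \<Longrightarrow> (\<And>x. x \<in> carrier A \<Longrightarrow> fn f x = fn g x) \<Longrightarrow> f = g"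
  by (cases f; cases g) (auto simp: Hom_ab intro: extensionalityI)

lemma Hom_ab_PiE: "f \<in> Hom ab_cat A B \<Longrightarrow> fn f \<in> carrier A \<rightarrow>\<^sub>E carrier B"
  by (auto simp: Hom_ab hom_def PiE_def)

lemma Hom_ab_one: "f \<in> Hom ab_cat A B \<Longrightarrow> fn f \<one>\<^bsub>A\<^esub> = \<one>\<^bsub>B\<^esub>"
  using hom_one[of "fn f" A B] by (simp add: Hom_ab comm_group_def)

lemma category_pset_cat: "category pset_cat"
proof (rule category.intro)
  fix f g X Y Z assume fg: "f \<in> Hom pset_cat X Y" "g \<in> Hom pset_cat Y Z"
  then have "compose (points X) (fn g) (fn f) \<in> points X \<rightarrow>\<^sub>E points Z"
    by (intro compose_in_PiE[of _ _ "points Y"]) (simp_all add: Hom_pset)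
  with fg show "Cmp pset_cat g f \<in> Hom pset_cat X Z"
    by (simp add: Hom_pset compose_def)
next
  fix f assume "f \<in> Ar pset_cat"
  then show "Dom pset_cat f \<in> Ob pset_cat \<and> Cod pset_cat f \<in> Ob pset_cat"
    by (auto simp: pset_cat_def)
qed (auto simp: Hom_pset compose_restrict_id compose_id_restrict compose_assoc_PiE arrow.expand)

lemma category_ab_cat: "category ab_cat"
proof (rule category.intro)
  fix f g X Y Z assume fg: "f \<in> Hom ab_cat X Y" "g \<in> Hom ab_cat Y Z"
  then show "Cmp ab_cat g f \<in> Hom ab_cat X Z"
    by (auto simp: Hom_ab hom_def compose_def monoid.m_closed comm_group_def group_def PiE_iff Pi_iff)
next
  fix f assume "f \<in> Ar ab_cat"
  then show "Dom ab_cat f \<in> Ob ab_cat \<and> Cod ab_cat f \<in> Ob ab_cat"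
    by (auto simp: ab_cat_def)
next
  fix X :: "'a monoid" assume "X \<in> Ob ab_cat"
  then have "monoid X" by (simp add: comm_group_def group_def)
  with \<open>X \<in> Ob ab_cat\<close> show "Ide ab_cat X \<in> Hom ab_cat X X"
    by (auto simp: Hom_ab hom_def monoid.m_closed)
next
  fix f X Y assume "f \<in> Hom (ab_cat :: ('a monoid, _) cat) X Y"
  with Hom_ab_PiE[OF this]
  show "Cmp ab_cat f (Ide ab_cat X) = f" "Cmp ab_cat (Ide ab_cat Y) f = f"
    by (auto simp: Hom_ab compose_restrict_id compose_id_restrict arrow.expand)
next
  fix f g h W X Y Z
  assume "f \<in> Hom (ab_cat :: ('a monoid, _) cat) W X" "g \<in> Hom ab_cat X Y" "h \<in> Hom ab_cat Y Z"
  with Hom_ab_PiE[OF this(1)]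
  show "Cmp ab_cat h (Cmp ab_cat g f) = Cmp ab_cat (Cmp ab_cat h g) f"
    by (auto simp: Hom_ab compose_assoc_PiE)
qed

section \<open>Bijective morphisms are isomorphisms, and the forgetful functor\<close>

lemma isomorphism_pset:
  assumes f: "f \<in> Hom pset_cat S T" and bij: "bij_betw (fn f) (points S) (points T)"
  shows "isomorphism pset_cat f"
proof (rule isomorphismI[OF f])
  let ?g = "\<lambda>y\<in>points T. inv_into (points S) (fn f) y"
  have inv: "inv_into (points S) (fn f) (fn f x) = x" if "x \<in> points S" for x
    using bij that by (simp add: bij_betw_def)
  have inv': "fn f (inv_into (points S) (fn f) y) = y" "inv_into (points S) (fn f) y \<in> points S"
    if "y \<in> points T" for y
    using bij that by (auto simp: bij_betw_def f_inv_into_f inv_into_into)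
  have [simp]: "src f = S" "tgt f = T" and b: "base S \<in> points S" "base T \<in> points T" "fn f (base S) = base T"
    and PiE: "fn f \<in> points S \<rightarrow>\<^sub>E points T"
    using f by (auto simp: Hom_pset)
  show "Arrow T S ?g \<in> Hom pset_cat T S"
    using inv[OF b(1)] inv' b by (simp add: Hom_pset)
  show "Cmp pset_cat (Arrow T S ?g) f = Ide pset_cat S" "Cmp pset_cat f (Arrow T S ?g) = Ide pset_cat T"
    using PiE by (auto simp: compose_def inv inv' intro!: restrict_ext)
qed

lemma isomorphism_ab:
  assumes f: "f \<in> Hom ab_cat A B" and bij: "bij_betw (fn f) (carrier A) (carrier B)"
  shows "isomorphism ab_cat f"
proof (rule isomorphismI[OF f])
  let ?g = "\<lambda>y\<in>carrier B. inv_into (carrier A) (fn f) y"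
  have "fn f \<in> iso A B" and A: "group A"
    using f bij by (auto simp: Hom_ab iso_def comm_group_def)
  then have "inv_into (carrier A) (fn f) \<in> hom B A"
    using group.iso_set_sym[OF A] by (auto simp: iso_def)
  \<comment> \<open>Arrows are extensional, so the inverse is cut off at the carrier; being a
    homomorphism only concerns the values there.\<close>
  then have "?g \<in> hom B A"
    using f by (auto simp: hom_def Hom_ab monoid.m_closed comm_group_def group_def)
  then show "Arrow B A ?g \<in> Hom ab_cat B A"
    using f by (auto simp: Hom_ab)
  have [simp]: "src f = A" "tgt f = B"
    using f by (auto simp: Hom_ab)
  show "Cmp ab_cat (Arrow B A ?g) f = Ide ab_cat A" "Cmp ab_cat f (Arrow B A ?g) = Ide ab_cat B"
    using bij Hom_ab_PiE[OF f]
    by (auto simp: compose_def bij_betw_def f_inv_into_f intro!: restrict_ext)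
qed

lemma forget_sel [simp]:
  "FOb forget A = forget_ob A" "fn (FAr forget f) = fn f" "src (FAr forget f) = forget_ob (src f)"
  "tgt (FAr forget f) = forget_ob (tgt f)" "points (forget_ob A) = carrier A" "base (forget_ob A) = \<one>\<^bsub>A\<^esub>"
  by (simp_all add: forget_def forget_ob_def)

lemma forget_Hom: "f \<in> Hom ab_cat A B \<Longrightarrow> FAr forget f \<in> Hom pset_cat (forget_ob A) (forget_ob B)"
  using Hom_ab_PiE[of f A B] Hom_ab_one[of f A B]
  by (auto simp: Hom_pset Hom_ab comm_group_def group_def monoid.one_closed)

lemma is_functor_forget: "is_functor ab_cat pset_cat forget"
proof (rule is_functorI)
  fix A :: "'a monoid" assume "A \<in> Ob ab_cat"
  then show "FOb forget A \<in> Ob pset_cat"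
    by (simp add: comm_group_def group_def monoid.one_closed)
qed (auto simp: category_pset_cat category_ab_cat forget_Hom arrow.expand)

section \<open>The reduced free abelian group\<close>

text \<open>The class of c modulo multiples of b, described by the coefficients away from b. In this
  form equality of classes is a comparison of coefficients, and the ambient set of points does not
  enter.\<close>

definition coset :: "'u \<Rightarrow> ('u \<Rightarrow>\<^sub>0 int) \<Rightarrow> ('u \<Rightarrow>\<^sub>0 int) set" where
  "coset b c = {d. \<forall>x. x \<noteq> b \<longrightarrow> Poly_Mapping.lookup d x = Poly_Mapping.lookup c x}"

lemma coset_range: "coset b c = range (\<lambda>k. c + frag_cmul k (frag_of b))"
proof (intro equalityI subsetI)
  fix d assume "d \<in> coset b c"
  then have "d = c + frag_cmul (Poly_Mapping.lookup d b - Poly_Mapping.lookup c b) (frag_of b)"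
    by (intro poly_mapping_eqI) (auto simp: coset_def lookup_add)
  then show "d \<in> range (\<lambda>k. c + frag_cmul k (frag_of b))" by blast
qed (auto simp: coset_def lookup_add)

lemma coset_eq_iff:
  "coset b c = coset b d \<longleftrightarrow> (\<forall>x. x \<noteq> b \<longrightarrow> Poly_Mapping.lookup c x = Poly_Mapping.lookup d x)"
  unfolding coset_def by (auto simp: set_eq_iff)

text \<open>The right-hand side does not depend on S, because the operation of a free abelian group
  is addition of finitely supported functions whatever the set of generators is.\<close>

lemma r_coset_free_Abelian_group:
  "carrier (free_Abelian_group {b}) #>\<^bsub>free_Abelian_group S\<^esub> c = coset b c"
proof -
  have "carrier (free_Abelian_group {b}) = range (\<lambda>k. frag_cmul k (frag_of b))"
  proof (intro equalityI subsetI)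
    fix h assume "h \<in> carrier (free_Abelian_group {b})"
    then have "h = frag_cmul (Poly_Mapping.lookup h b) (frag_of b)"
      by (intro poly_mapping_eqI) (auto simp: in_keys_iff)
    then show "h \<in> range (\<lambda>k. frag_cmul k (frag_of b))" by blast
  qed (auto simp: keys_frag_of)
  then show ?thesis
    by (auto simp: r_coset_def coset_range add.commute)
qed

lemma carrier_free_eq_coset: "carrier (free_Abelian_group {b}) = coset b 0"
  by (auto simp: coset_def subset_iff in_keys_iff)

lemma set_mult_coset: "coset b c <#>\<^bsub>free_Abelian_group S\<^esub> coset b d = coset b (c + d)"
proof (intro equalityI subsetI)
  fix x assume "x \<in> coset b (c + d)"
  then have "x - d \<in> coset b c" "d \<in> coset b d" "x = (x - d) + d"
    by (auto simp: coset_def lookup_add lookup_minus)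
  then show "x \<in> coset b c <#>\<^bsub>free_Abelian_group S\<^esub> coset b d"
    unfolding set_mult_def by force
qed (auto simp: coset_def set_mult_def lookup_add)

lemma quotient_free_sel:
  "carrier (quotient_free S) = coset (base S) ` {c. Poly_Mapping.keys c \<subseteq> points S}"
  "coset (base S) c \<otimes>\<^bsub>quotient_free S\<^esub> coset (base S) d = coset (base S) (c + d)"
  "\<one>\<^bsub>quotient_free S\<^esub> = coset (base S) 0"
proof -
  have "carrier (free_Abelian_group (points S)) = {c. Poly_Mapping.keys c \<subseteq> points S}"
    by auto
  then show "carrier (quotient_free S) = coset (base S) ` {c. Poly_Mapping.keys c \<subseteq> points S}"
    by (simp add: quotient_free_def carrier_FactGroup r_coset_free_Abelian_group)
qed (simp_all add: quotient_free_def set_mult_coset carrier_free_eq_coset)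

lemma coset_in_reduced_cosets: "coset b c \<in> reduced_cosets"
  unfolding reduced_cosets_def quotient_free_sel
  \<comment> \<open>The pointed set of all elements of \<open>'u\<close> contains every
    support.\<close>
  by (rule UN_I[of "Pset UNIV b"]) auto

text \<open>The element of the encoded group that stands for the class of c. The rules below let
  later arguments work with representatives c and leave \<open>enc\<close> and \<open>dec\<close>
  aside.\<close>

definition cls :: "(('u \<Rightarrow>\<^sub>0 int) set \<Rightarrow> 'u) \<Rightarrow> 'u \<Rightarrow> ('u \<Rightarrow>\<^sub>0 int) \<Rightarrow> 'u" where
  "cls enc b c = enc (coset b c)"

lemma dec_cls: "coset_coding enc \<Longrightarrow> dec enc (cls enc b c) = coset b c"
  by (simp add: cls_def dec_def coset_coding_def inv_into_f_f coset_in_reduced_cosets)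

text \<open>Injectivity of \<open>enc\<close> on the cosets enters here. Every later comparison of
  coefficients goes through this equivalence.\<close>

lemma cls_eq_iff:
  "coset_coding enc \<Longrightarrow> cls enc b c = cls enc b d \<longleftrightarrow>
    (\<forall>x. x \<noteq> b \<longrightarrow> Poly_Mapping.lookup c x = Poly_Mapping.lookup d x)"
  unfolding cls_def coset_coding_def
  by (simp add: inj_on_eq_iff coset_in_reduced_cosets coset_eq_iff)

lemma carrier_reduced_free:
  "carrier (reduced_free_ob enc S) = cls enc (base S) ` {c. Poly_Mapping.keys c \<subseteq> points S}"
  by (auto simp: reduced_free_ob_def quotient_free_sel cls_def)

lemma cls_in_carrier:
  "Poly_Mapping.keys c \<subseteq> points S \<Longrightarrow> cls enc (base S) c \<in> carrier (reduced_free_ob enc S)"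
  by (simp add: carrier_reduced_free)

lemma one_reduced_free: "\<one>\<^bsub>reduced_free_ob enc S\<^esub> = cls enc (base S) 0"
  by (simp add: reduced_free_ob_def quotient_free_sel cls_def)

lemma mult_reduced_free:
  "coset_coding enc \<Longrightarrow>
    cls enc (base S) c \<otimes>\<^bsub>reduced_free_ob enc S\<^esub> cls enc (base S) d = cls enc (base S) (c + d)"
  by (simp add: reduced_free_ob_def dec_cls quotient_free_sel) (simp add: cls_def)

lemma comm_group_reduced_free:
  assumes "coset_coding enc"
  shows "comm_group (reduced_free_ob enc S)"
proof (rule comm_groupI)
  fix x assume "x \<in> carrier (reduced_free_ob enc S)"
  then obtain c where c: "Poly_Mapping.keys c \<subseteq> points S" "x = cls enc (base S) c"
    by (auto simp: carrier_reduced_free)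
  then have "cls enc (base S) (- c) \<in> carrier (reduced_free_ob enc S)"
    by (simp add: cls_in_carrier)
  with c show "\<exists>y\<in>carrier (reduced_free_ob enc S). y \<otimes>\<^bsub>reduced_free_ob enc S\<^esub> x = \<one>\<^bsub>reduced_free_ob enc S\<^esub>"
    by (intro bexI[of _ "cls enc (base S) (- c)"]) (simp_all add: mult_reduced_free[OF assms] one_reduced_free)
next
  fix x y assume "x \<in> carrier (reduced_free_ob enc S)" "y \<in> carrier (reduced_free_ob enc S)"
  then obtain c d where cd: "Poly_Mapping.keys c \<subseteq> points S" "x = cls enc (base S) c"
    "Poly_Mapping.keys d \<subseteq> points S" "y = cls enc (base S) d"
    by (auto simp: carrier_reduced_free)
  then have "Poly_Mapping.keys (c + d) \<subseteq> points S" using keys_add[of c d] by blast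
  with cd show "x \<otimes>\<^bsub>reduced_free_ob enc S\<^esub> y \<in> carrier (reduced_free_ob enc S)"
    by (simp add: mult_reduced_free[OF assms] cls_in_carrier)
qed (auto simp: carrier_reduced_free mult_reduced_free[OF assms] one_reduced_free ac_simps)

text \<open>X may be smaller than the set of points: in \<open>coaction_evaluate\<close> it consists
  of the group-like elements inside a group.\<close>

lemma cls_hom:
  assumes "coset_coding enc" "X \<subseteq> points S"
  shows "cls enc (base S) \<in> hom (free_Abelian_group X) (reduced_free_ob enc S)"
  using assms(2) by (simp add: hom_def mult_reduced_free[OF assms(1)] cls_in_carrier subset_trans)

text \<open>Subtracting the multiple of the base generator does not change the class. In a
  representative normalised in this way every generator that occurs has a nonzero class, and its
  coefficient can be seen in the quotient.\<close>

lemma carrier_reduced_freeE: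
  assumes "coset_coding enc" "u \<in> carrier (reduced_free_ob enc S)"
  obtains c where "Poly_Mapping.keys c \<subseteq> points S - {base S}" "u = cls enc (base S) c"
proof -
  let ?b = "base S"
  obtain c where c: "Poly_Mapping.keys c \<subseteq> points S" "u = cls enc ?b c"
    using assms by (auto simp: carrier_reduced_free)
  define d where "d = c - frag_cmul (Poly_Mapping.lookup c ?b) (frag_of ?b)"
  have "Poly_Mapping.lookup d x = (if x = ?b then 0 else Poly_Mapping.lookup c x)" for x
    by (simp add: d_def lookup_minus)
  then have "Poly_Mapping.keys d \<subseteq> points S - {?b}" "u = cls enc ?b d"
    using c by (auto simp: in_keys_iff cls_eq_iff[OF assms(1)] split: if_splits)
  then show ?thesis by (rule that)
qed

section \<open>Pushing chains forward, and uniqueness of homomorphisms on free abelian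
  groups\<close>

abbreviation push :: "('u \<Rightarrow> 'v) \<Rightarrow> ('u \<Rightarrow>\<^sub>0 int) \<Rightarrow> ('v \<Rightarrow>\<^sub>0 int)" where
  "push f \<equiv> frag_extend (\<lambda>x. frag_of (f x))"

lemma keys_push: "Poly_Mapping.keys (push f c) \<subseteq> f ` Poly_Mapping.keys c"
  using keys_frag_extend[of "\<lambda>x. frag_of (f x)" c] by (auto simp: keys_frag_of)

lemma push_hom:
  "f ` X \<subseteq> Y \<Longrightarrow> push f \<in> hom (free_Abelian_group X) (free_Abelian_group Y)"
  using keys_push by (fastforce simp: hom_def frag_extend_add)

lemma push_compose: "push g (push f c) = push (\<lambda>x. g (f x)) c"
  using frag_extend_compose[of "\<lambda>x. frag_of (g x)" f c] by (simp add: o_def)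

lemma push_id: "(\<And>x. x \<in> Poly_Mapping.keys c \<Longrightarrow> f x = x) \<Longrightarrow> push f c = c"
  using frag_extend_eq[of c "\<lambda>x. frag_of (f x)" frag_of] frag_expansion[of c] by simp

text \<open>Injectivity rules out cancellation: only the term at x contributes to the coefficient at
  f x. Adding x to the support also covers the case that x does not occur in c.\<close>

lemma lookup_push_inj:
  assumes "inj_on f (insert x (Poly_Mapping.keys c))"
  shows "Poly_Mapping.lookup (push f c) (f x) = Poly_Mapping.lookup c x"
proof -
  have "Poly_Mapping.lookup (push f c) (f x) =
      (\<Sum>i\<in>Poly_Mapping.keys c. Poly_Mapping.lookup c i * (if f x = f i then 1 else 0))"
    by (simp add: frag_extend_def lookup_sum)
  also have "\<dots> = (\<Sum>i\<in>Poly_Mapping.keys c. if i = x then Poly_Mapping.lookup c i else 0)"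
    using assms by (intro sum.cong) (auto simp: inj_on_def)
  also have "\<dots> = Poly_Mapping.lookup c x"
    by (simp add: in_keys_iff)
  finally show ?thesis .
qed

lemma hom_free_Abelian_group_eqI:
  assumes "group G" and h: "h \<in> hom (free_Abelian_group X) G" and k: "k \<in> hom (free_Abelian_group X) G"
    and eq: "\<And>x. x \<in> X \<Longrightarrow> h (frag_of x) = k (frag_of x)"
    and c: "Poly_Mapping.keys c \<subseteq> X"
  shows "h c = k c"
proof -
  interpret h: group_hom "free_Abelian_group X" G h
    using h \<open>group G\<close> by (simp add: group_hom_def group_hom_axioms_def)
  interpret k: group_hom "free_Abelian_group X" G k
    using k \<open>group G\<close> by (simp add: group_hom_def group_hom_axioms_def)
  \<comment> \<open>The difference step of \<open>frag_induction\<close> says nothing about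
    supports, so the bound on the support is carried along in the induction predicate.\<close>
  have "Poly_Mapping.keys c \<subseteq> X \<and> h c = k c"
    using c
  proof (induction c rule: frag_induction)
    case zero then show ?case using h.hom_one k.hom_one by simp
  next
    case (one x) then show ?case by (simp add: eq keys_frag_of)
  next
    case (diff a b)
    then have "h (a + - b) = k (a + - b)"
      using h.hom_mult[of a "- b"] k.hom_mult[of a "- b"] h.hom_inv[of b] k.hom_inv[of b] by simp
    with diff keys_diff[of a b] show ?case by auto
  qed
  then show ?thesis ..
qed

lemma image_push_coset: "push f ` coset b c = coset (f b) (push f c)"
  by (simp add: coset_range image_image frag_extend_add frag_extend_cmul)

lemma reduced_free_sel [simp]:
  "FOb (reduced_free enc) = reduced_free_ob enc"
  "src (FAr (reduced_free enc) f) = reduced_free_ob enc (src f)"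
  "tgt (FAr (reduced_free enc) f) = reduced_free_ob enc (tgt f)"
  by (simp_all add: reduced_free_def)

lemma reduced_free_cls:
  assumes "coset_coding enc" "f \<in> Hom pset_cat S T" "Poly_Mapping.keys c \<subseteq> points S"
  shows "fn (FAr (reduced_free enc) f) (cls enc (base S) c) = cls enc (base T) (push (fn f) c)"
  using assms
  by (auto simp: reduced_free_def cls_in_carrier dec_cls image_push_coset Hom_pset) (simp add: cls_def)

lemma reduced_free_Hom:
  assumes enc: "coset_coding enc" and f: "f \<in> Hom pset_cat S T"
  shows "FAr (reduced_free enc) f \<in> Hom ab_cat (reduced_free_ob enc S) (reduced_free_ob enc T)"
proof -
  have fS: "fn f ` points S \<subseteq> points T" "src f = S" "tgt f = T" using f by (auto simp: Hom_pset)
  have k: "Poly_Mapping.keys (push (fn f) c) \<subseteq> points T" if "Poly_Mapping.keys c \<subseteq> points S" for c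
    using that keys_push[of "fn f" c] fS by blast
  have a: "Poly_Mapping.keys (c + d) \<subseteq> points S"
    if "Poly_Mapping.keys c \<subseteq> points S" "Poly_Mapping.keys d \<subseteq> points S" for c d
    using that keys_add[of c d] by blast
  have "fn (FAr (reduced_free enc) f) \<in> hom (reduced_free_ob enc S) (reduced_free_ob enc T)"
    by (auto simp: hom_def carrier_reduced_free reduced_free_cls[OF enc f] k a
        mult_reduced_free[OF enc] frag_extend_add)
  moreover have "fn (FAr (reduced_free enc) f) \<in> extensional (carrier (reduced_free_ob enc S))"
    by (simp add: reduced_free_def fS)
  ultimately show ?thesis
    by (simp add: Hom_ab comm_group_reduced_free[OF enc] fS)
qed

lemma is_functor_reduced_free:
  assumes enc: "coset_coding enc"
  shows "is_functor pset_cat ab_cat (reduced_free enc)"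
proof (rule is_functorI)
  fix S :: "'a pset" assume S: "S \<in> Ob pset_cat"
  interpret P: category "pset_cat :: ('a pset, _) cat" by (rule category_pset_cat)
  interpret A: category "ab_cat :: ('a monoid, _) cat" by (rule category_ab_cat)
  show "FAr (reduced_free enc) (Ide pset_cat S) = Ide ab_cat (FOb (reduced_free enc) S)"
  proof (rule ab_arrow_eqI)
    show "FAr (reduced_free enc) (Ide pset_cat S) \<in> Hom ab_cat (reduced_free_ob enc S) (reduced_free_ob enc S)"
      by (rule reduced_free_Hom[OF enc P.ide[OF S]])
    show "Ide ab_cat (FOb (reduced_free enc) S) \<in> Hom ab_cat (reduced_free_ob enc S) (reduced_free_ob enc S)"
      using A.ide comm_group_reduced_free[OF enc] by force
    fix u assume u: "u \<in> carrier (reduced_free_ob enc S)"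
    then obtain c where c: "Poly_Mapping.keys c \<subseteq> points S" "u = cls enc (base S) c"
      by (auto simp: carrier_reduced_free)
    then have "push (\<lambda>x\<in>points S. x) c = c" by (intro push_id) auto
    then show "fn (FAr (reduced_free enc) (Ide pset_cat S)) u = fn (Ide ab_cat (FOb (reduced_free enc) S)) u"
      using u reduced_free_cls[OF enc P.ide[OF S] c(1)] by (simp add: c(2))
  qed
next
  fix f g :: "('a pset, 'a \<Rightarrow> 'a) arrow" and X Y Z
  assume f: "f \<in> Hom pset_cat X Y" and g: "g \<in> Hom pset_cat Y Z"
  interpret P: category "pset_cat :: ('a pset, _) cat" by (rule category_pset_cat)
  interpret A: category "ab_cat :: ('a monoid, _) cat" by (rule category_ab_cat)
  have fX: "fn f ` points X \<subseteq> points Y" "src f = X" "src g = Y" using f g by (auto simp: Hom_pset)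
  note Zf = reduced_free_Hom[OF enc f] and Zg = reduced_free_Hom[OF enc g]
  show "FAr (reduced_free enc) (Cmp pset_cat g f) = Cmp ab_cat (FAr (reduced_free enc) g) (FAr (reduced_free enc) f)"
  proof (rule ab_arrow_eqI[OF reduced_free_Hom[OF enc P.cmp[OF f g]] A.cmp[OF Zf Zg]])
    fix u assume u: "u \<in> carrier (reduced_free_ob enc X)"
    then obtain c where c: "Poly_Mapping.keys c \<subseteq> points X" "u = cls enc (base X) c"
      by (auto simp: carrier_reduced_free)
    have k: "Poly_Mapping.keys (push (fn f) c) \<subseteq> points Y"
      using c(1) keys_push[of "fn f" c] fX by blast
    \<comment> \<open>A pushforward depends only on values on the support, so the default value of
      \<open>compose\<close> outside the points is never reached.\<close>
    have "push (compose (points X) (fn g) (fn f)) c = push (\<lambda>x. fn g (fn f x)) c"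
      using c(1) by (intro frag_extend_eq) (auto simp: compose_def)
    then show "fn (FAr (reduced_free enc) (Cmp pset_cat g f)) u =
        fn (Cmp ab_cat (FAr (reduced_free enc) g) (FAr (reduced_free enc) f)) u"
      using u reduced_free_cls[OF enc P.cmp[OF f g] c(1)]
      by (simp add: c(2) fX compose_def reduced_free_cls[OF enc f c(1)] reduced_free_cls[OF enc g k] push_compose)
  qed
qed (auto simp: category_pset_cat category_ab_cat comm_group_reduced_free[OF enc] reduced_free_Hom[OF enc])

text \<open>Enlarging the index set only adds powers with exponent 0. Additivity of evaluation needs
  this, since c, d and c + d have different supports.\<close>

lemma evaluate_eq_finprod:
  assumes "comm_group A" "finite I" "Poly_Mapping.keys c \<subseteq> I" "I \<subseteq> carrier A"
  shows "evaluate A c = (\<Otimes>\<^bsub>A\<^esub>x\<in>I. x [^]\<^bsub>A\<^esub> (Poly_Mapping.lookup c x :: int))"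
proof -
  interpret comm_group A by fact
  show ?thesis
    unfolding evaluate_def using assms
    by (intro finprod_mono_neutral_cong_left) (auto simp: in_keys_iff)
qed

lemma evaluate_hom:
  assumes "comm_group A" "X \<subseteq> carrier A"
  shows "evaluate A \<in> hom (free_Abelian_group X) A"
proof -
  interpret comm_group A by fact
  show ?thesis
  proof (rule homI)
    fix c assume "c \<in> carrier (free_Abelian_group X)"
    then have "Poly_Mapping.keys c \<subseteq> X" by simp
    then show "evaluate A c \<in> carrier A"
      using assms(2) unfolding evaluate_def by (intro finprod_closed) auto
  next
    fix c d assume "c \<in> carrier (free_Abelian_group X)" "d \<in> carrier (free_Abelian_group X)"
    then have c: "Poly_Mapping.keys c \<subseteq> carrier A" and d: "Poly_Mapping.keys d \<subseteq> carrier A"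
      using assms(2) by auto
    let ?I = "Poly_Mapping.keys c \<union> Poly_Mapping.keys d"
    have I: "finite ?I" "?I \<subseteq> carrier A" using c d by auto
    have pow: "x [^]\<^bsub>A\<^esub> (Poly_Mapping.lookup e x :: int) \<in> carrier A" if "x \<in> ?I" for x e
      using that I by (intro int_pow_closed) auto
    have "evaluate A (c + d) = (\<Otimes>\<^bsub>A\<^esub>x\<in>?I. x [^]\<^bsub>A\<^esub> (Poly_Mapping.lookup (c + d) x :: int))"
      by (rule evaluate_eq_finprod[OF assms(1) I(1) keys_add I(2)])
    also have "\<dots> = (\<Otimes>\<^bsub>A\<^esub>x\<in>?I. x [^]\<^bsub>A\<^esub> (Poly_Mapping.lookup c x :: int) \<otimes>\<^bsub>A\<^esub> x [^]\<^bsub>A\<^esub> (Poly_Mapping.lookup d x :: int))"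
      using I(2) pow by (intro finprod_cong') (auto simp: lookup_add int_pow_mult)
    also have "\<dots> = evaluate A c \<otimes>\<^bsub>A\<^esub> evaluate A d"
      using pow evaluate_eq_finprod[OF assms(1) I(1) _ I(2), of c] evaluate_eq_finprod[OF assms(1) I(1) _ I(2), of d]
      by (simp add: finprod_multf Pi_def)
    finally show "evaluate A (c \<otimes>\<^bsub>free_Abelian_group X\<^esub> d) = evaluate A c \<otimes>\<^bsub>A\<^esub> evaluate A d"
      by simp
  qed
qed

lemma evaluate_cmul_frag_of:
  assumes "comm_group A" "x \<in> carrier A"
  shows "evaluate A (frag_cmul k (frag_of x)) = x [^]\<^bsub>A\<^esub> k"
proof -
  interpret comm_group A by fact
  have "evaluate A (frag_cmul k (frag_of x)) =
      (\<Otimes>\<^bsub>A\<^esub>y\<in>{x}. y [^]\<^bsub>A\<^esub> (Poly_Mapping.lookup (frag_cmul k (frag_of x)) y :: int))"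
    using assms by (intro evaluate_eq_finprod) auto
  also have "\<dots> = x [^]\<^bsub>A\<^esub> k"
    using assms(2) by (simp del: finprod_singleton)
  finally show ?thesis .
qed

lemma evaluate_frag_of:
  assumes "comm_group A" "x \<in> carrier A"
  shows "evaluate A (frag_of x) = x"
  using evaluate_cmul_frag_of[OF assms, of 1] assms
  by (simp add: group.int_pow_1 comm_group_def)

text \<open>Both sides are homomorphisms in c, so generators suffice. This avoids collecting terms
  by hand when f identifies points of the support.\<close>

lemma evaluate_push:
  assumes f: "f \<in> hom A B" and "comm_group A" "comm_group B"
    and c: "Poly_Mapping.keys c \<subseteq> carrier A"
  shows "evaluate B (push f c) = f (evaluate A c)"
proof (rule hom_free_Abelian_group_eqI[OF _ _ _ _ c])
  show "group B" using assms by (simp add: comm_group_def)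
  have fA: "f ` carrier A \<subseteq> carrier B" using f by (auto simp: hom_def)
  show "(\<lambda>c. evaluate B (push f c)) \<in> hom (free_Abelian_group (carrier A)) B"
    using hom_compose[OF push_hom[OF fA] evaluate_hom[OF assms(3) order_refl]] by (simp add: o_def)
  show "(\<lambda>c. f (evaluate A c)) \<in> hom (free_Abelian_group (carrier A)) B"
    using hom_compose[OF evaluate_hom[OF assms(2) order_refl] f] by (simp add: o_def)
  show "evaluate B (push f (frag_of x)) = f (evaluate A (frag_of x))" if "x \<in> carrier A" for x
    using that fA assms by (simp add: evaluate_frag_of image_subset_iff)
qed

text \<open>The base point of the underlying pointed set is the neutral element, whose powers are
  trivial; shifting a chain by a multiple of it leaves the value unchanged. This justifies
  \<open>the_elem\<close> in \<open>linearize\<close>.\<close>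

lemma evaluate_coset:
  assumes "comm_group A" "Poly_Mapping.keys c \<subseteq> carrier A"
  shows "evaluate A ` coset \<one>\<^bsub>A\<^esub> c = {evaluate A c}"
proof -
  interpret comm_group A by fact
  have "evaluate A (c + frag_cmul k (frag_of \<one>\<^bsub>A\<^esub>)) = evaluate A c" for k
    using hom_mult[OF evaluate_hom[OF assms(1) order_refl], of c "frag_cmul k (frag_of \<one>\<^bsub>A\<^esub>)"]
      hom_in_carrier[OF evaluate_hom[OF assms(1) order_refl], of c]
    using assms keys_frag_of by (simp add: evaluate_cmul_frag_of[OF assms(1)] keys_cmul[THEN order_trans])
  then show ?thesis
    by (simp add: coset_range image_image)
qed

section \<open>The adjunction between pointed sets and abelian groups\<close>

lemma linearize_sel [simp]:
  "src (linearize enc A) = reduced_free_ob enc (forget_ob A)" "tgt (linearize enc A) = A"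
  by (simp_all add: linearize_def)

lemma linearize_cls:
  assumes "coset_coding enc" "comm_group A" "Poly_Mapping.keys c \<subseteq> carrier A"
  shows "fn (linearize enc A) (cls enc \<one>\<^bsub>A\<^esub> c) = evaluate A c"
  using cls_in_carrier[of c "forget_ob A" enc] assms
  by (simp add: linearize_def dec_cls evaluate_coset)

lemma carrier_reduced_free_forget:
  "carrier (reduced_free_ob enc (forget_ob A)) = cls enc \<one>\<^bsub>A\<^esub> ` {c. Poly_Mapping.keys c \<subseteq> carrier A}"
  by (simp add: carrier_reduced_free)

lemma linearize_Hom:
  assumes enc: "coset_coding enc" and A: "comm_group A"
  shows "linearize enc A \<in> Hom ab_cat (reduced_free_ob enc (forget_ob A)) A"
proof -
  interpret ev: group_hom "free_Abelian_group (carrier A)" A "evaluate A"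
    using A evaluate_hom[OF A order_refl] by (simp add: group_hom_def group_hom_axioms_def comm_group_def)
  have "fn (linearize enc A) \<in> hom (reduced_free_ob enc (forget_ob A)) A"
  proof (rule homI)
    fix u v assume "u \<in> carrier (reduced_free_ob enc (forget_ob A))" "v \<in> carrier (reduced_free_ob enc (forget_ob A))"
    then obtain c d where cd: "Poly_Mapping.keys c \<subseteq> carrier A" "u = cls enc \<one>\<^bsub>A\<^esub> c"
      "Poly_Mapping.keys d \<subseteq> carrier A" "v = cls enc \<one>\<^bsub>A\<^esub> d"
      by (auto simp: carrier_reduced_free_forget)
    have "Poly_Mapping.keys (c + d) \<subseteq> carrier A" using cd keys_add[of c d] by blast
    then show "fn (linearize enc A) (u \<otimes>\<^bsub>reduced_free_ob enc (forget_ob A)\<^esub> v) =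
        fn (linearize enc A) u \<otimes>\<^bsub>A\<^esub> fn (linearize enc A) v"
      using cd mult_reduced_free[OF enc, of "forget_ob A" c d] ev.hom_mult[of c d]
      by (simp add: linearize_cls[OF enc A])
  qed (use ev.hom_closed in \<open>auto simp: carrier_reduced_free_forget linearize_cls[OF enc A]\<close>)
  moreover have "fn (linearize enc A) \<in> extensional (carrier (reduced_free_ob enc (forget_ob A)))"
    by (simp add: linearize_def)
  ultimately show ?thesis
    by (simp add: Hom_ab comm_group_reduced_free[OF enc] A)
qed

lemma hurewicz_sel [simp]:
  "src (hurewicz enc S) = S" "tgt (hurewicz enc S) = forget_ob (reduced_free_ob enc S)"
  "x \<in> points S \<Longrightarrow> fn (hurewicz enc S) x = cls enc (base S) (frag_of x)"
  by (simp_all add: hurewicz_def r_coset_free_Abelian_group cls_def)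

lemma cls_frag_of_base: "coset_coding enc \<Longrightarrow> cls enc b (frag_of b) = cls enc b 0"
  by (simp add: cls_eq_iff)

text \<open>The base point is included: its class is zero, while any other point has coefficient 1
  at a place that the quotient still sees.\<close>

lemma cls_frag_of_inj: "coset_coding enc \<Longrightarrow> cls enc b (frag_of x) = cls enc b (frag_of y) \<longleftrightarrow> x = y"
  by (auto simp: cls_eq_iff split: if_splits)

lemma hurewicz_Hom:
  assumes "coset_coding enc" "base S \<in> points S"
  shows "hurewicz enc S \<in> Hom pset_cat S (forget_ob (reduced_free_ob enc S))"
proof -
  have "fn (hurewicz enc S) \<in> extensional (points S)" by (simp add: hurewicz_def)
  then show ?thesis
    using assms cls_in_carrier[of 0 S enc]
    by (auto simp: Hom_pset PiE_def one_reduced_free cls_frag_of_base intro!: cls_in_carrier)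
qed

lemma hurewicz_inj: "coset_coding enc \<Longrightarrow> inj_on (fn (hurewicz enc S)) (points S)"
  by (auto simp: inj_on_def cls_frag_of_inj)

lemma adjunction_reduced_free_forget:
  fixes enc :: "('u \<Rightarrow>\<^sub>0 int) set \<Rightarrow> 'u"
  assumes enc: "coset_coding enc"
  shows "adjunction pset_cat ab_cat (reduced_free enc) forget (hurewicz enc) (linearize enc)"
proof (rule adjunction.intro)
  interpret P: category "pset_cat :: ('u pset, _) cat" by (rule category_pset_cat)
  interpret A: category "ab_cat :: ('u monoid, _) cat" by (rule category_ab_cat)
  note Z = is_functor_reduced_free[OF enc]
  have [simp]: "FOb id_functor X = X" "FAr id_functor f = f" for X f
    by (simp_all add: id_functor_def)
  have [simp]: "FOb (comp_functor G F) X = FOb G (FOb F X)"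
    "FAr (comp_functor G F) f = FAr G (FAr F f)" for G F X f
    by (simp_all add: comp_functor_def)
  show "is_functor pset_cat ab_cat (reduced_free enc)" by (rule Z)
  show "is_functor ab_cat pset_cat forget" by (rule is_functor_forget)
  show "nat_trans pset_cat pset_cat id_functor (comp_functor forget (reduced_free enc)) (hurewicz enc)"
  proof (rule nat_transI)
    fix f :: "('u pset, 'u \<Rightarrow> 'u) arrow" and S T assume f: "f \<in> Hom pset_cat S T"
    then have ST: "base S \<in> points S" "base T \<in> points T" and [simp]: "src f = S" "tgt f = T"
      by (auto simp: Hom_pset)
    have fS: "fn f x \<in> points T" if "x \<in> points S" for x
      using f that by (auto simp: Hom_pset)
    have "Cmp pset_cat (hurewicz enc T) f = Cmp pset_cat (FAr forget (FAr (reduced_free enc) f)) (hurewicz enc S)"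
    proof (rule pset_arrow_eqI)
      show "Cmp pset_cat (hurewicz enc T) f \<in> Hom pset_cat S (forget_ob (reduced_free_ob enc T))"
        by (rule P.cmp[OF f hurewicz_Hom[OF enc ST(2)]])
      show "Cmp pset_cat (FAr forget (FAr (reduced_free enc) f)) (hurewicz enc S)
          \<in> Hom pset_cat S (forget_ob (reduced_free_ob enc T))"
        by (rule P.cmp[OF hurewicz_Hom[OF enc ST(1)] forget_Hom[OF reduced_free_Hom[OF enc f]]])
      fix x assume "x \<in> points S"
      then show "fn (Cmp pset_cat (hurewicz enc T) f) x =
          fn (Cmp pset_cat (FAr forget (FAr (reduced_free enc) f)) (hurewicz enc S)) x"
        by (simp add: compose_def fS reduced_free_cls[OF enc f])
    qed
    then show "Cmp pset_cat (hurewicz enc T) (FAr id_functor f) =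
        Cmp pset_cat (FAr (comp_functor forget (reduced_free enc)) f) (hurewicz enc S)"
      by (simp del: pset_cat_sel)
  qed (use hurewicz_Hom[OF enc] in \<open>auto intro!: is_functor_id is_functor_comp Z is_functor_forget category_pset_cat\<close>)
  show "nat_trans ab_cat ab_cat (comp_functor (reduced_free enc) forget) id_functor (linearize enc)"
  proof (rule nat_transI)
    fix f :: "('u monoid, 'u \<Rightarrow> 'u) arrow" and G H assume f: "f \<in> Hom ab_cat G H"
    then have G: "comm_group G" and H: "comm_group H" and [simp]: "src f = G" "tgt f = H"
      and hom: "fn f \<in> hom G H"
      by (auto simp: Hom_ab)
    note Zf = reduced_free_Hom[OF enc forget_Hom[OF f]]
    have "Cmp ab_cat (linearize enc H) (FAr (reduced_free enc) (FAr forget f)) = Cmp ab_cat f (linearize enc G)"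
    proof (rule ab_arrow_eqI[OF A.cmp[OF Zf linearize_Hom[OF enc H]] A.cmp[OF linearize_Hom[OF enc G] f]])
      fix u assume u: "u \<in> carrier (reduced_free_ob enc (forget_ob G))"
      then obtain c where c: "Poly_Mapping.keys c \<subseteq> carrier G" "u = cls enc \<one>\<^bsub>G\<^esub> c"
        by (auto simp: carrier_reduced_free_forget)
      have "Poly_Mapping.keys (push (fn f) c) \<subseteq> carrier H"
        using c(1) keys_push[of "fn f" c] hom_carrier[OF hom] by blast
      then show "fn (Cmp ab_cat (linearize enc H) (FAr (reduced_free enc) (FAr forget f))) u =
          fn (Cmp ab_cat f (linearize enc G)) u"
        using u c reduced_free_cls[OF enc forget_Hom[OF f], of c]
        by (simp add: compose_def linearize_cls[OF enc] G H evaluate_push[OF hom G H])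
    qed
    then show "Cmp ab_cat (linearize enc H) (FAr (comp_functor (reduced_free enc) forget) f) =
        Cmp ab_cat (FAr id_functor f) (linearize enc G)"
      by (simp del: ab_cat_sel)
  qed (use linearize_Hom[OF enc] in \<open>auto intro!: is_functor_id is_functor_comp Z is_functor_forget category_ab_cat\<close>)
next
  interpret A: category "ab_cat :: ('u monoid, _) cat" by (rule category_ab_cat)
  fix S :: "'u pset" assume S: "S \<in> Ob pset_cat"
  let ?Z = "reduced_free_ob enc S"
  note Z = comm_group_reduced_free[OF enc, of S]
  have \<eta>: "hurewicz enc S \<in> Hom pset_cat S (forget_ob ?Z)" using S hurewicz_Hom[OF enc] by simp
  have \<eta>S: "fn (hurewicz enc S) ` points S \<subseteq> carrier ?Z" by (auto simp: cls_in_carrier)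
  show "Cmp ab_cat (linearize enc (FOb (reduced_free enc) S)) (FAr (reduced_free enc) (hurewicz enc S)) =
      Ide ab_cat (FOb (reduced_free enc) S)"
    unfolding reduced_free_sel
  proof (rule ab_arrow_eqI[OF A.cmp[OF reduced_free_Hom[OF enc \<eta>] linearize_Hom[OF enc Z]]])
    show "Ide ab_cat ?Z \<in> Hom ab_cat ?Z ?Z" using Z by (intro A.ide) simp
    fix u assume u: "u \<in> carrier ?Z"
    then obtain c where c: "Poly_Mapping.keys c \<subseteq> points S" "u = cls enc (base S) c"
      by (auto simp: carrier_reduced_free)
    have k: "Poly_Mapping.keys (push (fn (hurewicz enc S)) c) \<subseteq> carrier ?Z"
      using c(1) keys_push[of "fn (hurewicz enc S)" c] \<eta>S by blast
    \<comment> \<open>As functions of c both sides are homomorphisms that take the generator x to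
      its class.\<close>
    have "evaluate ?Z (push (fn (hurewicz enc S)) c) = cls enc (base S) c"
    proof (rule hom_free_Abelian_group_eqI[OF _ _ _ _ c(1)])
      show "group ?Z" using Z by (simp add: comm_group_def)
      show "(\<lambda>c. evaluate ?Z (push (fn (hurewicz enc S)) c)) \<in> hom (free_Abelian_group (points S)) ?Z"
        using hom_compose[OF push_hom[OF \<eta>S] evaluate_hom[OF Z order_refl]] by (simp add: o_def)
      show "cls enc (base S) \<in> hom (free_Abelian_group (points S)) ?Z"
        by (rule cls_hom[OF enc order_refl])
      fix x assume "x \<in> points S"
      then show "evaluate ?Z (push (fn (hurewicz enc S)) (frag_of x)) = cls enc (base S) (frag_of x)"
        by (simp add: evaluate_frag_of[OF Z] cls_in_carrier)
    qed
    then show "fn (Cmp ab_cat (linearize enc ?Z) (FAr (reduced_free enc) (hurewicz enc S))) u = fn (Ide ab_cat ?Z) u"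
      using u c(2) reduced_free_cls[OF enc \<eta> c(1)] linearize_cls[OF enc Z k]
      by (simp add: compose_def)
  qed
next
  interpret P: category "pset_cat :: ('u pset, _) cat" by (rule category_pset_cat)
  fix G :: "'u monoid" assume "G \<in> Ob ab_cat"
  then have G: "comm_group G" and 1: "\<one>\<^bsub>G\<^esub> \<in> carrier G"
    by (simp_all add: comm_group_def group_def monoid.one_closed)
  have \<eta>: "hurewicz enc (forget_ob G) \<in> Hom pset_cat (forget_ob G) (forget_ob (reduced_free_ob enc (forget_ob G)))"
    using hurewicz_Hom[OF enc, of "forget_ob G"] 1 by simp
  show "Cmp pset_cat (FAr forget (linearize enc G)) (hurewicz enc (FOb forget G)) = Ide pset_cat (FOb forget G)"
    unfolding forget_sel
  proof (rule pset_arrow_eqI[OF P.cmp[OF \<eta> forget_Hom[OF linearize_Hom[OF enc G]]]])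
    show "Ide pset_cat (forget_ob G) \<in> Hom pset_cat (forget_ob G) (forget_ob G)"
      using 1 by (intro P.ide) simp
    fix x assume "x \<in> points (forget_ob G)"
    then show "fn (Cmp pset_cat (FAr forget (linearize enc G)) (hurewicz enc (forget_ob G))) x =
        fn (Ide pset_cat (forget_ob G)) x"
      by (simp add: compose_def linearize_cls[OF enc G] evaluate_frag_of[OF G])
  qed
qed

text \<open>Both \<open>\<Sum> n\<^sub>i [[x\<^sub>i]]\<close> and \<open>[\<Sum> n\<^sub>i [x\<^sub>i]]\<close> are reduced expressions in a free abelian
  group, so comparing coefficients leaves a single term with \<open>n = 1\<close>.\<close>

lemma hurewicz_image:
  fixes enc :: "('u \<Rightarrow>\<^sub>0 int) set \<Rightarrow> 'u"
  assumes enc: "coset_coding enc" and S: "base S \<in> points S"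
    and u: "u \<in> carrier (reduced_free_ob enc S)"
    and eq: "fn (FAr (reduced_free enc) (hurewicz enc S)) u = fn (hurewicz enc (forget_ob (reduced_free_ob enc S))) u"
  shows "u \<in> fn (hurewicz enc S) ` points S"
proof -
  let ?Z = "reduced_free_ob enc S" and ?\<eta> = "fn (hurewicz enc S)"
  obtain c where c: "Poly_Mapping.keys c \<subseteq> points S - {base S}" "u = cls enc (base S) c"
    using carrier_reduced_freeE[OF enc u] .
  have "Poly_Mapping.keys c \<subseteq> points S" using c(1) by blast
  from reduced_free_cls[OF enc hurewicz_Hom[OF enc S] this]
  have "cls enc \<one>\<^bsub>?Z\<^esub> (push ?\<eta> c) = cls enc \<one>\<^bsub>?Z\<^esub> (frag_of u)"
    using eq u by (simp add: c(2)[symmetric])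
  \<comment> \<open>The equation lives in a free group whose base point is the neutral element of
    \<open>?Z\<close>, so it determines all coefficients except the one there.\<close>
  then have coeff: "Poly_Mapping.lookup (push ?\<eta> c) y = (if y = u then 1 else 0)" if "y \<noteq> \<one>\<^bsub>?Z\<^esub>" for y
    using that by (simp add: cls_eq_iff[OF enc])
  show ?thesis
  proof (cases "c = 0")
    case True
    \<comment> \<open>Here u is the zero class, which is the image of the base point.\<close>
    then show ?thesis using c(2) S cls_frag_of_base[OF enc, of "base S"] by (intro image_eqI[of _ _ "base S"]) auto
  next
    case False
    then obtain x where x: "x \<in> Poly_Mapping.keys c" using keys_eq_empty by blast
    then have xS: "x \<in> points S" "x \<noteq> base S" using c(1) by auto
    have "?\<eta> x \<noteq> \<one>\<^bsub>?Z\<^esub>"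
      using xS S cls_frag_of_inj[OF enc, of "base S" x "base S"] cls_frag_of_base[OF enc, of "base S"]
      by (simp add: one_reduced_free)
    moreover have "Poly_Mapping.lookup (push ?\<eta> c) (?\<eta> x) = Poly_Mapping.lookup c x"
      using inj_on_subset[OF hurewicz_inj[OF enc, of S]] c(1) xS by (intro lookup_push_inj) blast
    \<comment> \<open>The right-hand side of \<open>coeff\<close> is supported at u alone, so a
      single nonzero coefficient at \<open>?\<eta> x\<close> already identifies the two.\<close>
    ultimately have "?\<eta> x = u"
      using coeff[of "?\<eta> x"] x by (auto simp: in_keys_iff split: if_splits)
    then show ?thesis using xS by blast
  qed
qed

section \<open>Coalgebras in a single simplicial degree\<close>

abbreviation level_comonad where
  "level_comonad enc \<equiv> adjunction_comonad (reduced_free enc) forget (hurewicz enc) (linearize enc)"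

text \<open>Named after the group-like elements of a coalgebra. They are in general not closed under
  the operation of A: they are the prospective generators, together with the neutral element as base
  point.\<close>

definition group_likes :: "(('u \<Rightarrow>\<^sub>0 int) set \<Rightarrow> 'u) \<Rightarrow> 'u monoid \<Rightarrow> ('u monoid, 'u \<Rightarrow> 'u) arrow \<Rightarrow> 'u set" where
  "group_likes enc A d = {x \<in> carrier A. fn d x = fn (hurewicz enc (forget_ob A)) x}"

lemma coalgebra_levelD:
  fixes enc :: "('u \<Rightarrow>\<^sub>0 int) set \<Rightarrow> 'u"
  assumes enc: "coset_coding enc" and co: "coalgebra ab_cat (level_comonad enc) A d"
  shows "comm_group A" "d \<in> Hom ab_cat A (reduced_free_ob enc (forget_ob A))"
    and "a \<in> carrier A \<Longrightarrow> fn (linearize enc A) (fn d a) = a"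
    and "a \<in> carrier A \<Longrightarrow> fn (FAr (reduced_free enc) (FAr forget d)) (fn d a) =
      fn (FAr (reduced_free enc) (hurewicz enc (forget_ob A))) (fn d a)"
proof -
  show A: "comm_group A" and d: "d \<in> Hom ab_cat A (reduced_free_ob enc (forget_ob A))"
    using co by (simp_all add: coalgebra_def adjunction_comonad_def comp_functor_def)
  have [simp]: "src d = A" using d by (simp add: Hom_ab)
  have 1: "Cmp ab_cat (linearize enc A) d = Ide ab_cat A"
    and 2: "Cmp ab_cat (FAr (reduced_free enc) (FAr forget d)) d =
      Cmp ab_cat (FAr (reduced_free enc) (hurewicz enc (forget_ob A))) d"
    using co by (simp_all add: coalgebra_def adjunction_comonad_def comp_functor_def del: ab_cat_sel)
  show "fn (linearize enc A) (fn d a) = a" if "a \<in> carrier A"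
    using arg_cong[OF 1, of "\<lambda>f. fn f a"] that by (simp add: compose_def)
  show "fn (FAr (reduced_free enc) (FAr forget d)) (fn d a) =
      fn (FAr (reduced_free enc) (hurewicz enc (forget_ob A))) (fn d a)" if "a \<in> carrier A"
    using arg_cong[OF 2, of "\<lambda>f. fn f a"] that by (simp add: compose_def)
qed

text \<open>If \<open>\<delta> a = \<Sum> n\<^sub>i [x\<^sub>i]\<close>, then coassociativity reads \<open>\<Sum> n\<^sub>i [\<delta> x\<^sub>i] = \<Sum> n\<^sub>i [[x\<^sub>i]]\<close>.
  Hence each \<open>[x\<^sub>i]\<close> is some \<open>\<delta> x\<^sub>j\<close>, and the counit axiom gives \<open>i = j\<close>.\<close>

lemma coaction_group_likes:
  fixes enc :: "('u \<Rightarrow>\<^sub>0 int) set \<Rightarrow> 'u"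
  assumes enc: "coset_coding enc" and co: "coalgebra ab_cat (level_comonad enc) A d"
    and a: "a \<in> carrier A"
  obtains c where "Poly_Mapping.keys c \<subseteq> group_likes enc A d" "fn d a = cls enc \<one>\<^bsub>A\<^esub> c"
proof -
  note A = coalgebra_levelD(1)[OF enc co] and d = coalgebra_levelD(2)[OF enc co]
  let ?U = "forget_ob A"
  let ?Z = "reduced_free_ob enc ?U" and ?\<eta> = "fn (hurewicz enc ?U)"
  have 1: "\<one>\<^bsub>A\<^esub> \<in> carrier A"
    using A by (simp add: comm_group_def group_def monoid.one_closed)
  have da: "fn d a \<in> carrier ?Z" using d a by (auto simp: Hom_ab hom_def)
  \<comment> \<open>The neutral element must be left out of the support: its class is zero, so the
    next comparison could not see its coefficient.\<close>
  obtain c where c: "Poly_Mapping.keys c \<subseteq> carrier A - {\<one>\<^bsub>A\<^esub>}" "fn d a = cls enc \<one>\<^bsub>A\<^esub> c"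
    using carrier_reduced_freeE[OF enc da] by auto
  have \<eta>: "hurewicz enc ?U \<in> Hom pset_cat ?U (forget_ob ?Z)"
    using 1 by (intro hurewicz_Hom[OF enc]) simp
  have "cls enc \<one>\<^bsub>?Z\<^esub> (push (fn d) c) = cls enc \<one>\<^bsub>?Z\<^esub> (push ?\<eta> c)"
    using coalgebra_levelD(4)[OF enc co a] reduced_free_cls[OF enc \<eta>, of c]
      reduced_free_cls[OF enc forget_Hom[OF d], of c] c by (simp add: subset_Diff_insert)
  then have coeff: "Poly_Mapping.lookup (push (fn d) c) y = Poly_Mapping.lookup (push ?\<eta> c) y"
    if "y \<noteq> \<one>\<^bsub>?Z\<^esub>" for y
    using that by (simp add: cls_eq_iff[OF enc])
  have "x \<in> group_likes enc A d" if x: "x \<in> Poly_Mapping.keys c" for x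
  proof -
    have xA: "x \<in> carrier A" "x \<noteq> \<one>\<^bsub>A\<^esub>" using c(1) x by auto
    have "?\<eta> x \<noteq> \<one>\<^bsub>?Z\<^esub>"
      using xA 1 cls_frag_of_inj[OF enc, of "\<one>\<^bsub>A\<^esub>" x "\<one>\<^bsub>A\<^esub>"] cls_frag_of_base[OF enc, of "\<one>\<^bsub>A\<^esub>"]
      by (simp add: one_reduced_free)
    \<comment> \<open>No terms merge on this side because distinct points have distinct classes;
      hence the class of x occurs with the nonzero coefficient of x.\<close>
    moreover have "Poly_Mapping.lookup (push ?\<eta> c) (?\<eta> x) = Poly_Mapping.lookup c x"
      using c(1) xA by (intro lookup_push_inj inj_on_subset[OF hurewicz_inj[OF enc]]) auto
    ultimately have "?\<eta> x \<in> Poly_Mapping.keys (push (fn d) c)"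
      using coeff[of "?\<eta> x"] x by (simp add: in_keys_iff)
    \<comment> \<open>On the side of the coaction terms might merge, but anything that occurs in a
      pushforward is the image of some point of the support.\<close>
    then obtain y where y: "y \<in> Poly_Mapping.keys c" "?\<eta> x = fn d y"
      using keys_push[of "fn d" c] by blast
    \<comment> \<open>Evaluation sends the coaction of y to y and the class of x to x.\<close>
    have "y = fn (linearize enc A) (?\<eta> x)"
      using y c(1) coalgebra_levelD(3)[OF enc co, of y] by auto
    also have "\<dots> = x"
      using xA by (simp add: linearize_cls[OF enc A] evaluate_frag_of[OF A])
    finally show ?thesis using y xA by (simp add: group_likes_def)
  qed
  then show ?thesis using c(2) that by blast
qed

text \<open>On chains of group-like elements the coaction undoes evaluation: both sides are
  homomorphisms in c, and on a generator the equation is the defining property of group-like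
  elements.\<close>

lemma coaction_evaluate:
  fixes enc :: "('u \<Rightarrow>\<^sub>0 int) set \<Rightarrow> 'u"
  assumes enc: "coset_coding enc" and co: "coalgebra ab_cat (level_comonad enc) A d"
    and c: "Poly_Mapping.keys c \<subseteq> group_likes enc A d"
  shows "fn d (evaluate A c) = cls enc \<one>\<^bsub>A\<^esub> c"
proof (rule hom_free_Abelian_group_eqI[OF _ _ _ _ c])
  note A = coalgebra_levelD(1)[OF enc co] and d = coalgebra_levelD(2)[OF enc co]
  let ?Z = "reduced_free_ob enc (forget_ob A)"
  have G: "group_likes enc A d \<subseteq> carrier A" by (auto simp: group_likes_def)
  show "group ?Z" using comm_group_reduced_free[OF enc] by (simp add: comm_group_def)
  have "fn d \<in> hom A ?Z" using d by (simp add: Hom_ab)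
  from hom_compose[OF evaluate_hom[OF A G] this]
  show "(\<lambda>c. fn d (evaluate A c)) \<in> hom (free_Abelian_group (group_likes enc A d)) ?Z" by (simp add: o_def)
  show "cls enc \<one>\<^bsub>A\<^esub> \<in> hom (free_Abelian_group (group_likes enc A d)) ?Z"
    using cls_hom[OF enc, of "group_likes enc A d" "forget_ob A"] G by simp
  show "fn d (evaluate A (frag_of x)) = cls enc \<one>\<^bsub>A\<^esub> (frag_of x)" if "x \<in> group_likes enc A d" for x
    using that by (simp add: group_likes_def evaluate_frag_of[OF A])
qed

text \<open>Injective because the coaction recovers a class from its value; surjective because a is
  the value of a chain of group-like elements that represents its coaction. S and h are left open so
  that they can be a level of the equalizer and of the comparison counit.\<close>

lemma bij_betw_evaluate_group_likes:
  fixes enc :: "('u \<Rightarrow>\<^sub>0 int) set \<Rightarrow> 'u"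
  assumes enc: "coset_coding enc" and co: "coalgebra ab_cat (level_comonad enc) A d"
    and S: "points S = group_likes enc A d" "base S = \<one>\<^bsub>A\<^esub>"
    and h: "\<And>c. Poly_Mapping.keys c \<subseteq> points S \<Longrightarrow> h (cls enc \<one>\<^bsub>A\<^esub> c) = evaluate A c"
  shows "bij_betw h (carrier (reduced_free_ob enc S)) (carrier A)"
proof -
  note A = coalgebra_levelD(1)[OF enc co]
  have carr: "carrier (reduced_free_ob enc S) = cls enc \<one>\<^bsub>A\<^esub> ` {c. Poly_Mapping.keys c \<subseteq> points S}"
    by (simp add: carrier_reduced_free S)
  have G: "group_likes enc A d \<subseteq> carrier A" by (auto simp: group_likes_def)
  have "inj_on h (carrier (reduced_free_ob enc S))"
  proof (rule inj_onI)
    fix u v assume "u \<in> carrier (reduced_free_ob enc S)" "v \<in> carrier (reduced_free_ob enc S)" and eq: "h u = h v"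
    then obtain c e where ce: "Poly_Mapping.keys c \<subseteq> points S" "u = cls enc \<one>\<^bsub>A\<^esub> c"
      "Poly_Mapping.keys e \<subseteq> points S" "v = cls enc \<one>\<^bsub>A\<^esub> e"
      by (auto simp: carr)
    then have "fn d (evaluate A c) = fn d (evaluate A e)" using eq by (simp add: h)
    with ce show "u = v" by (simp add: coaction_evaluate[OF enc co] S)
  qed
  moreover have "h u \<in> carrier A" if "u \<in> carrier (reduced_free_ob enc S)" for u
    using that hom_in_carrier[OF evaluate_hom[OF A G]] by (auto simp: carr h S)
  moreover have "a \<in> h ` carrier (reduced_free_ob enc S)" if a: "a \<in> carrier A" for a
  proof -
    obtain c where c: "Poly_Mapping.keys c \<subseteq> group_likes enc A d" "fn d a = cls enc \<one>\<^bsub>A\<^esub> c"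
      using coaction_group_likes[OF enc co a] .
    have "a = evaluate A c"
      using coalgebra_levelD(3)[OF enc co a] c G linearize_cls[OF enc A, of c] by auto
    then show ?thesis using c by (auto simp: carr h S intro!: image_eqI[of _ _ "cls enc \<one>\<^bsub>A\<^esub> c"])
  qed
  ultimately show ?thesis by (auto simp: bij_betw_def)
qed

section \<open>Equalizers of pointed simplicial sets\<close>

lemma pset_arrow_at:
  "f \<in> Hom pset_cat S T \<Longrightarrow> x \<in> points S \<Longrightarrow> fn f x \<in> points T"
  by (auto simp: Hom_pset)

lemma pset_cmp_at:
  "f \<in> Hom pset_cat S T \<Longrightarrow> x \<in> points S \<Longrightarrow> fn (Cmp pset_cat g f) x = fn g (fn f x)"
  by (auto simp: Hom_pset compose_def)

lemma spset_map_natural_at: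
  assumes "f \<in> Hom (simplicial pset_cat) X Y" "\<theta> \<in> Hom simplex_cat m n" "x \<in> points (FOb X n)"
  shows "fn (fn f m) (fn (FAr X \<theta>) x) = fn (FAr Y \<theta>) (fn (fn f n) x)"
proof -
  have X: "X \<in> Ob (simplicial pset_cat)" using assms(1) by (simp add: Hom_simplicial)
  from arg_cong[OF simplicial_map_natural[OF assms(1,2)], of "\<lambda>f. fn f x"]
  show ?thesis
    by (simp only: pset_cmp_at[OF simplicial_ob_arrow[OF X assms(2)] assms(3)]
        pset_cmp_at[OF simplicial_map_level[OF assms(1)] assms(3)])
qed

lemma spset_map_eqI:
  assumes f: "f \<in> Hom (simplicial pset_cat) X Y" and g: "g \<in> Hom (simplicial pset_cat) X Y"
    and eq: "\<And>n x. x \<in> points (FOb X n) \<Longrightarrow> fn (fn f n) x = fn (fn g n) x"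
  shows "f = g"
proof -
  have "fn f = fn g"
    by (rule ext) (rule pset_arrow_eqI[OF simplicial_map_level[OF f] simplicial_map_level[OF g] eq])
  moreover have "src f = src g" "tgt f = tgt g" using f g by (auto simp: Hom_simplicial)
  ultimately show ?thesis by (simp add: arrow.expand)
qed

lemma equalizer_level_sel [simp]:
  "src f = X \<Longrightarrow> points (equalizer_level f g n) = {x \<in> points (FOb X n). fn (fn f n) x = fn (fn g n) x}"
  "src f = X \<Longrightarrow> base (equalizer_level f g n) = base (FOb X n)"
  by (simp_all add: equalizer_level_def)

locale parallel_maps =
  fixes f g :: "'u spset_map" and X Y :: "'u spset"
  assumes f: "f \<in> Hom (simplicial pset_cat) X Y" and g: "g \<in> Hom (simplicial pset_cat) X Y"
begin

lemma X: "X \<in> Ob (simplicial pset_cat)" and src_f [simp]: "src f = X"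
  using f by (auto simp: Hom_simplicial)

lemma X_base: "base (FOb X n) \<in> points (FOb X n)"
  using simplicial_ob_level[OF X] by simp

lemma level_base: "base (equalizer_level f g n) \<in> points (equalizer_level f g n)"
  using X_base simplicial_map_level[OF f, of n] simplicial_map_level[OF g, of n] by (simp add: Hom_pset)

text \<open>Both f and g commute with the simplicial operators, so these preserve the points at
  which f and g agree.\<close>

lemma X_arrow_equalizer:
  assumes \<theta>: "\<theta> \<in> Hom simplex_cat m n" and x: "x \<in> points (equalizer_level f g n)"
  shows "fn (FAr X \<theta>) x \<in> points (equalizer_level f g m)"
  using x pset_arrow_at[OF simplicial_ob_arrow[OF X \<theta>], of x]
    spset_map_natural_at[OF f \<theta>, of x] spset_map_natural_at[OF g \<theta>, of x] by simp

lemma equalizer_ob [simp]: "FOb (equalizer f g) n = equalizer_level f g n"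
  by (simp add: equalizer_def)

lemma equalizer_arrow:
  "\<theta> \<in> Hom simplex_cat m n \<Longrightarrow> FAr (equalizer f g) \<theta> =
    Arrow (equalizer_level f g n) (equalizer_level f g m)
      (restrict (fn (FAr X \<theta>)) (points (equalizer_level f g n)))"
  by (auto simp: equalizer_def in_Hom_iff)

lemma equalizer_arrow_Hom:
  assumes \<theta>: "\<theta> \<in> Hom simplex_cat m n"
  shows "FAr (equalizer f g) \<theta> \<in> Hom pset_cat (equalizer_level f g n) (equalizer_level f g m)"
  using X_arrow_equalizer[OF \<theta>] level_base[of m] level_base[of n] simplicial_ob_arrow[OF X \<theta>]
  unfolding equalizer_arrow[OF \<theta>] by (simp add: Hom_pset del: equalizer_level_sel(1))

lemma equalizer_simplicial: "equalizer f g \<in> Ob (simplicial pset_cat)"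
proof -
  interpret S: category simplex_cat by (rule category_simplex_cat)
  interpret P: category "pset_cat :: ('u pset, _) cat" by (rule category_pset_cat)
  interpret X: is_functor "opposite simplex_cat" pset_cat X
    using X by (simp add: Ob_simplicial)
  have "is_functor (opposite simplex_cat) pset_cat (equalizer f g)"
  proof (rule is_functorI)
    fix n assume "n \<in> Ob (opposite simplex_cat)"
    have i: "Ide simplex_cat n \<in> Hom simplex_cat n n" by (rule S.ide) simp
    have "FAr (equalizer f g) (Ide simplex_cat n) = Ide pset_cat (equalizer_level f g n)"
    proof (rule pset_arrow_eqI[OF equalizer_arrow_Hom[OF i] P.ide])
      fix x assume x: "x \<in> points (equalizer_level f g n)"
      then show "fn (FAr (equalizer f g) (Ide simplex_cat n)) x = fn (Ide pset_cat (equalizer_level f g n)) x"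
        using X.fun_ide[of n] unfolding equalizer_arrow[OF i] by simp
    qed (use level_base in simp)
    then show "FAr (equalizer f g) (Ide (opposite simplex_cat) n) = Ide pset_cat (FOb (equalizer f g) n)"
      by (simp del: pset_cat_sel simplex_cat_sel)
  next
    fix \<theta> \<phi> k m n
    assume "\<theta> \<in> Hom (opposite simplex_cat) k m" "\<phi> \<in> Hom (opposite simplex_cat) m n"
    then have \<theta>: "\<theta> \<in> Hom simplex_cat m k" and \<phi>: "\<phi> \<in> Hom simplex_cat n m" by simp_all
    note \<theta>\<phi> = S.cmp[OF \<phi> \<theta>]
    have "FAr (equalizer f g) (Cmp simplex_cat \<theta> \<phi>) =
        Cmp pset_cat (FAr (equalizer f g) \<phi>) (FAr (equalizer f g) \<theta>)"
    proof (rule pset_arrow_eqI[OF equalizer_arrow_Hom[OF \<theta>\<phi>]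
          P.cmp[OF equalizer_arrow_Hom[OF \<theta>] equalizer_arrow_Hom[OF \<phi>]]])
      fix x assume x: "x \<in> points (equalizer_level f g k)"
      then have xX: "x \<in> points (FOb X k)" by simp
      have "fn (FAr X (Cmp simplex_cat \<theta> \<phi>)) x = fn (FAr X \<phi>) (fn (FAr X \<theta>) x)"
        using X.fun_cmp[of \<theta> k m \<phi> n] \<theta> \<phi> pset_cmp_at[OF simplicial_ob_arrow[OF X \<theta>] xX, of "FAr X \<phi>"]
        by (simp del: pset_cat_sel simplex_cat_sel)
      with x X_arrow_equalizer[OF \<theta> x]
      show "fn (FAr (equalizer f g) (Cmp simplex_cat \<theta> \<phi>)) x =
          fn (Cmp pset_cat (FAr (equalizer f g) \<phi>) (FAr (equalizer f g) \<theta>)) x"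
        by (simp only: pset_cmp_at[OF equalizer_arrow_Hom[OF \<theta>] x])
          (simp only: equalizer_arrow[OF \<theta>] equalizer_arrow[OF \<phi>] equalizer_arrow[OF \<theta>\<phi>]
            arrow.sel restrict_apply' simp_thms if_True)
    qed
    then show "FAr (equalizer f g) (Cmp (opposite simplex_cat) \<phi> \<theta>) =
        Cmp pset_cat (FAr (equalizer f g) \<phi>) (FAr (equalizer f g) \<theta>)"
      by (simp del: pset_cat_sel simplex_cat_sel)
  qed (use level_base equalizer_arrow_Hom in
      \<open>auto simp: category_opposite category_simplex_cat category_pset_cat simp del: equalizer_level_sel\<close>)
  then show ?thesis
    by (simp add: Ob_simplicial) (simp add: equalizer_def)
qed

lemma equalizer_incl_level:
  "fn (equalizer_incl f g) n =
    Arrow (equalizer_level f g n) (FOb X n) (\<lambda>x\<in>points (equalizer_level f g n). x)"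
  by (simp add: equalizer_incl_def del: equalizer_level_sel)

lemma equalizer_incl_level_Hom: "fn (equalizer_incl f g) n \<in> Hom pset_cat (equalizer_level f g n) (FOb X n)"
  using level_base[of n] X_base[of n] unfolding equalizer_incl_level by (auto simp: Hom_pset)

lemma equalizer_incl_Hom: "equalizer_incl f g \<in> Hom (simplicial pset_cat) (equalizer f g) X"
proof -
  interpret P: category "pset_cat :: ('u pset, _) cat" by (rule category_pset_cat)
  have "Arrow (equalizer f g) X (fn (equalizer_incl f g)) \<in> Hom (simplicial pset_cat) (equalizer f g) X"
  proof (rule simplicial_mapI[OF equalizer_simplicial X])
    show "fn (equalizer_incl f g) n \<in> Hom pset_cat (FOb (equalizer f g) n) (FOb X n)" for n
      using equalizer_incl_level_Hom by simp
    fix \<theta> m n assume \<theta>: "\<theta> \<in> Hom simplex_cat m n"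
    show "Cmp pset_cat (fn (equalizer_incl f g) m) (FAr (equalizer f g) \<theta>) =
        Cmp pset_cat (FAr X \<theta>) (fn (equalizer_incl f g) n)"
    proof (rule pset_arrow_eqI[OF P.cmp[OF equalizer_arrow_Hom[OF \<theta>] equalizer_incl_level_Hom]
          P.cmp[OF equalizer_incl_level_Hom simplicial_ob_arrow[OF X \<theta>]]])
      fix x assume x: "x \<in> points (equalizer_level f g n)"
      with X_arrow_equalizer[OF \<theta> x]
      show "fn (Cmp pset_cat (fn (equalizer_incl f g) m) (FAr (equalizer f g) \<theta>)) x =
          fn (Cmp pset_cat (FAr X \<theta>) (fn (equalizer_incl f g) n)) x"
        by (simp only: pset_cmp_at[OF equalizer_arrow_Hom[OF \<theta>] x] pset_cmp_at[OF equalizer_incl_level_Hom x])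
          (simp only: equalizer_arrow[OF \<theta>] equalizer_incl_level arrow.sel restrict_apply' simp_thms if_True)
    qed
  qed
  then show ?thesis by (simp add: equalizer_incl_def)
qed

lemma equalizer_incl_at: "x \<in> points (equalizer_level f g n) \<Longrightarrow> fn (fn (equalizer_incl f g) n) x = x"
  by (simp add: equalizer_incl_level)

lemma equalizer_incl_equalizes:
  "Cmp (simplicial pset_cat) f (equalizer_incl f g) = Cmp (simplicial pset_cat) g (equalizer_incl f g)"
proof -
  interpret S: category "simplicial pset_cat :: ('u spset, _) cat"
    by (rule category_simplicial[OF category_pset_cat])
  note i = equalizer_incl_Hom
  show ?thesis
  proof (rule spset_map_eqI[OF S.cmp[OF i f] S.cmp[OF i g]])
    fix n x assume "x \<in> points (FOb (equalizer f g) n)"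
    then have x: "x \<in> points (equalizer_level f g n)" by simp
    then show "fn (fn (Cmp (simplicial pset_cat) f (equalizer_incl f g)) n) x =
        fn (fn (Cmp (simplicial pset_cat) g (equalizer_incl f g)) n) x"
      by (simp add: pset_cmp_at[OF equalizer_incl_level_Hom x] equalizer_incl_at[OF x]
          del: pset_cat_sel equalizer_level_sel(1)) simp
  qed
qed

lemma equalizer_incl_cmp_at:
  assumes h: "h \<in> Hom (simplicial pset_cat) Z (equalizer f g)" and x: "x \<in> points (FOb Z n)"
  shows "fn (fn (Cmp (simplicial pset_cat) (equalizer_incl f g) h) n) x = fn (fn h n) x"
proof -
  note hn = simplicial_map_level[OF h, of n, unfolded equalizer_ob]
  show ?thesis
    using pset_arrow_at[OF hn x]
    by (simp add: pset_cmp_at[OF hn x] equalizer_incl_at del: pset_cat_sel equalizer_level_sel(1))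
qed

lemma equalizer_incl_monic:
  assumes h: "h \<in> Hom (simplicial pset_cat) Z (equalizer f g)"
    and k: "k \<in> Hom (simplicial pset_cat) Z (equalizer f g)"
    and eq: "Cmp (simplicial pset_cat) (equalizer_incl f g) h = Cmp (simplicial pset_cat) (equalizer_incl f g) k"
  shows "h = k"
proof (rule spset_map_eqI[OF h k])
  fix n x assume "x \<in> points (FOb Z n)"
  then show "fn (fn h n) x = fn (fn k n) x"
    using equalizer_incl_cmp_at[OF h] equalizer_incl_cmp_at[OF k] eq by metis
qed

text \<open>The lift is h with its codomain cut down. It is given explicitly because the comparison
  unit, and V on arrows, have exactly this form.\<close>

lemma equalizer_lift:
  assumes h: "h \<in> Hom (simplicial pset_cat) Z X"
    and eq: "Cmp (simplicial pset_cat) f h = Cmp (simplicial pset_cat) g h"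
  defines "l \<equiv> Arrow Z (equalizer f g) (\<lambda>n. Arrow (FOb Z n) (FOb (equalizer f g) n) (fn (fn h n)))"
  shows "l \<in> Hom (simplicial pset_cat) Z (equalizer f g)"
    and "Cmp (simplicial pset_cat) (equalizer_incl f g) l = h"
proof -
  interpret P: category "pset_cat :: ('u pset, _) cat" by (rule category_pset_cat)
  interpret S: category "simplicial pset_cat :: ('u spset, _) cat"
    by (rule category_simplicial[OF category_pset_cat])
  have Z: "Z \<in> Ob (simplicial pset_cat)" using h by (simp add: Hom_simplicial)
  note hn = simplicial_map_level[OF h]
  have hE: "fn (fn h n) x \<in> points (equalizer_level f g n)" if x: "x \<in> points (FOb Z n)" for n x
    using arg_cong[OF eq, of "\<lambda>f. fn (fn f n) x"] pset_arrow_at[OF hn x]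
    by (simp add: pset_cmp_at[OF hn x] del: pset_cat_sel)
  have ln: "Arrow (FOb Z n) (equalizer_level f g n) (fn (fn h n)) \<in> Hom pset_cat (FOb Z n) (equalizer_level f g n)" for n
    using hn[of n] hE[of _ n] level_base[of n] by (auto simp: Hom_pset PiE_iff simp del: equalizer_level_sel(1))
  show l: "l \<in> Hom (simplicial pset_cat) Z (equalizer f g)"
    unfolding l_def equalizer_ob
  proof (rule simplicial_mapI[OF Z equalizer_simplicial])
    show "Arrow (FOb Z n) (equalizer_level f g n) (fn (fn h n)) \<in> Hom pset_cat (FOb Z n) (FOb (equalizer f g) n)" for n
      using ln by simp
    fix \<theta> m n assume \<theta>: "\<theta> \<in> Hom simplex_cat m n"
    note Z\<theta> = simplicial_ob_arrow[OF Z \<theta>]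
    show "Cmp pset_cat (Arrow (FOb Z m) (equalizer_level f g m) (fn (fn h m))) (FAr Z \<theta>) =
        Cmp pset_cat (FAr (equalizer f g) \<theta>) (Arrow (FOb Z n) (equalizer_level f g n) (fn (fn h n)))"
    proof (rule pset_arrow_eqI[OF P.cmp[OF Z\<theta> ln] P.cmp[OF ln equalizer_arrow_Hom[OF \<theta>]]])
      fix x assume x: "x \<in> points (FOb Z n)"
      show "fn (Cmp pset_cat (Arrow (FOb Z m) (equalizer_level f g m) (fn (fn h m))) (FAr Z \<theta>)) x =
        fn (Cmp pset_cat (FAr (equalizer f g) \<theta>) (Arrow (FOb Z n) (equalizer_level f g n) (fn (fn h n)))) x"
        using hE[OF x] spset_map_natural_at[OF h \<theta> x]
        by (simp only: pset_cmp_at[OF Z\<theta> x] pset_cmp_at[OF ln x])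
          (simp only: equalizer_arrow[OF \<theta>] arrow.sel restrict_apply' simp_thms if_True)
    qed
  qed
  show "Cmp (simplicial pset_cat) (equalizer_incl f g) l = h"
  proof (rule spset_map_eqI[OF S.cmp[OF l equalizer_incl_Hom] h])
    fix n x assume "x \<in> points (FOb Z n)"
    then show "fn (fn (Cmp (simplicial pset_cat) (equalizer_incl f g) l) n) x = fn (fn h n) x"
      using equalizer_incl_cmp_at[OF l] by (simp add: l_def del: simplicial_sel)
  qed
qed

end

section \<open>The comparison adjunction\<close>

lemma adjunction_Z_tilde_U:
  assumes "coset_coding enc"
  shows "adjunction sSet_pointed sAb (Z_tilde enc) U_functor (eta enc) (eps enc)"
proof -
  have "eta enc = levelwise_trans id_functor (comp_functor forget (reduced_free enc)) (hurewicz enc)"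
    "eps enc = levelwise_trans (comp_functor (reduced_free enc) forget) id_functor (linearize enc)"
    by (simp_all add: fun_eq_iff eta_def eps_def)
  then show ?thesis
    using adjunction_levelwise[OF adjunction_reduced_free_forget[OF assms]]
    by (simp add: sSet_pointed_def sAb_def Z_tilde_def U_functor_def)
qed

lemma coAlg_parallel_maps:
  fixes enc :: "('u \<Rightarrow>\<^sub>0 int) set \<Rightarrow> 'u"
  assumes enc: "coset_coding enc" and P: "P \<in> Ob (coAlg enc)"
  shows "parallel_maps (FAr U_functor (snd P)) (eta enc (FOb U_functor (fst P)))
    (FOb U_functor (fst P)) (FOb U_functor (FOb (Z_tilde enc) (FOb U_functor (fst P))))"
proof -
  interpret adjunction sSet_pointed sAb "Z_tilde enc" U_functor "eta enc" "eps enc"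
    by (rule adjunction_Z_tilde_U[OF enc])
  have "fst P \<in> Ob sAb" and d: "snd P \<in> Hom sAb (fst P) (FOb (Z_tilde enc) (FOb U_functor (fst P)))"
    using P by (auto simp: coAlg_def Ob_coalg_cat coalgebra_def K_comonad_def adjunction_comonad_def comp_functor_def)
  then show ?thesis
    using R.ar[OF d] unt_Hom[OF R.ob]
    by (simp add: parallel_maps_def sSet_pointed_def[symmetric])
qed

lemma V_functor_ob:
  "FOb (V_functor enc) P = equalizer (FAr U_functor (snd P)) (eta enc (FOb U_functor (fst P)))"
  by (simp add: V_functor_def V_ob_def split: prod.split)

lemma V_incl_eq:
  "V_incl enc P = equalizer_incl (FAr U_functor (snd P)) (eta enc (FOb U_functor (fst P)))"
  by (simp add: V_incl_def split: prod.split)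

text \<open>What has to be checked is the universal property of the equalizer: the inclusion is
  monic, and both V on arrows and the unit are lifts along it.\<close>

lemma comparison_adjunction_coAlg:
  fixes enc :: "('u \<Rightarrow>\<^sub>0 int) set \<Rightarrow> 'u"
  assumes enc: "coset_coding enc"
  shows "comparison_adjunction sSet_pointed sAb (Z_tilde enc) U_functor (eta enc) (eps enc)
    (V_functor enc) (V_incl enc) (comparison_unit enc)"
proof -
  interpret adjunction sSet_pointed sAb "Z_tilde enc" U_functor "eta enc" "eps enc"
    by (rule adjunction_Z_tilde_U[OF enc])
  have E: "coalg_cat sAb (adjunction_comonad (Z_tilde enc) U_functor (eta enc) (eps enc)) = coAlg enc"
    by (simp add: coAlg_def K_comonad_def)
  note par = coAlg_parallel_maps[OF enc]
  note S = sSet_pointed_def[symmetric]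
  note assoc = L.source.assoc
  show ?thesis
  proof (unfold_locales, unfold E)
    fix P assume P: "P \<in> Ob (coAlg enc)"
    interpret par: parallel_maps "FAr U_functor (snd P)" "eta enc (FOb U_functor (fst P))" "FOb U_functor (fst P)"
      "FOb U_functor (FOb (Z_tilde enc) (FOb U_functor (fst P)))" by (rule par[OF P])
    show "V_incl enc P \<in> Hom sSet_pointed (FOb (V_functor enc) P) (FOb U_functor (fst P))"
      using par.equalizer_incl_Hom by (simp add: V_incl_eq V_functor_ob S)
    show "Cmp sSet_pointed (FAr U_functor (snd P)) (V_incl enc P) =
        Cmp sSet_pointed (eta enc (FOb U_functor (fst P))) (V_incl enc P)"
      using par.equalizer_incl_equalizes by (simp only: V_incl_eq S)
    show "h = k" if "h \<in> Hom sSet_pointed X (FOb (V_functor enc) P)" "k \<in> Hom sSet_pointed X (FOb (V_functor enc) P)"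
      "Cmp sSet_pointed (V_incl enc P) h = Cmp sSet_pointed (V_incl enc P) k" for h k X
      using that par.equalizer_incl_monic[of h X k] by (simp only: V_incl_eq V_functor_ob S)
  next
    fix f P Q assume f: "f \<in> Hom (coAlg enc) P Q"
    then have P: "P \<in> Ob (coAlg enc)" and Q: "Q \<in> Ob (coAlg enc)"
      and f': "fn f \<in> Hom sAb (fst P) (fst Q)"
      and cf: "Cmp sAb (snd Q) (fn f) = Cmp sAb (FAr (Z_tilde enc) (FAr U_functor (fn f))) (snd P)"
      and [simp]: "src f = P" "tgt f = Q"
      by (auto simp: coAlg_def Hom_coalg_cat K_comonad_def adjunction_comonad_def comp_functor_def)
    interpret P: parallel_maps "FAr U_functor (snd P)" "eta enc (FOb U_functor (fst P))" "FOb U_functor (fst P)"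
      "FOb U_functor (FOb (Z_tilde enc) (FOb U_functor (fst P)))" by (rule par[OF P])
    interpret Q: parallel_maps "FAr U_functor (snd Q)" "eta enc (FOb U_functor (fst Q))" "FOb U_functor (fst Q)"
      "FOb U_functor (FOb (Z_tilde enc) (FOb U_functor (fst Q)))" by (rule par[OF Q])
    let ?h = "Cmp sSet_pointed (FAr U_functor (fn f)) (V_incl enc P)"
    have i: "V_incl enc P \<in> Hom sSet_pointed (FOb (V_functor enc) P) (FOb U_functor (fst P))"
      using P.equalizer_incl_Hom by (simp add: V_incl_eq V_functor_ob S)
    note Uf = R.ar[OF f'] and ZUf = L.ar[OF R.ar[OF f']]
    have h: "?h \<in> Hom sSet_pointed (FOb (V_functor enc) P) (FOb U_functor (fst Q))"
      by (rule L.source.cmp[OF i Uf])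
    have dP: "snd P \<in> Hom sAb (fst P) (FOb (Z_tilde enc) (FOb U_functor (fst P)))"
      and dQ: "snd Q \<in> Hom sAb (fst Q) (FOb (Z_tilde enc) (FOb U_functor (fst Q)))"
      using P Q by (auto simp: coAlg_def Ob_coalg_cat coalgebra_def K_comonad_def adjunction_comonad_def comp_functor_def)
    note UdP = P.f[unfolded S] and etaP = P.g[unfolded S] and UdQ = Q.f[unfolded S] and etaQ = Q.g[unfolded S]
    \<comment> \<open>The map to be lifted must equalize the pair of Q. The coaction square of f
      moves the question to P, the equalizer property of P replaces the coaction by the unit, and
      naturality of the unit moves back to Q.\<close>
    have "Cmp sSet_pointed (FAr U_functor (snd Q)) ?h =
        Cmp sSet_pointed (FAr U_functor (Cmp sAb (snd Q) (fn f))) (V_incl enc P)"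
      by (simp only: assoc[OF i Uf UdQ] R.fun_cmp[OF f' dQ])
    also have "\<dots> = Cmp sSet_pointed (FAr U_functor (FAr (Z_tilde enc) (FAr U_functor (fn f))))
        (Cmp sSet_pointed (FAr U_functor (snd P)) (V_incl enc P))"
      by (simp only: cf R.fun_cmp[OF dP ZUf] assoc[OF i UdP R.ar[OF ZUf]])
    also have "\<dots> = Cmp sSet_pointed (FAr U_functor (FAr (Z_tilde enc) (FAr U_functor (fn f))))
        (Cmp sSet_pointed (eta enc (FOb U_functor (fst P))) (V_incl enc P))"
      using P.equalizer_incl_equalizes by (simp only: V_incl_eq S)
    also have "\<dots> = Cmp sSet_pointed (eta enc (FOb U_functor (fst Q))) ?h"
      by (simp only: assoc[OF i etaP R.ar[OF ZUf]] unt_nat[OF Uf] assoc[OF i Uf etaQ])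
    finally have eq: "Cmp sSet_pointed (FAr U_functor (snd Q)) ?h = Cmp sSet_pointed (eta enc (FOb U_functor (fst Q))) ?h" .
    \<comment> \<open>Composing with the inclusion amounts to restricting, so the lift is V on f as
      defined.\<close>
    have "fn (fn ?h n) = restrict (fn (fn (FAr U_functor (fn f)) n)) (points (FOb (FOb (V_functor enc) P) n))" for n
      by (auto simp: sSet_pointed_def V_incl_eq V_functor_ob P.equalizer_incl_level compose_def
          simp del: equalizer_level_sel(1) intro!: restrict_ext)
    then have V: "FAr (V_functor enc) f = Arrow (FOb (V_functor enc) P) (FOb (V_functor enc) Q)
        (\<lambda>n. Arrow (FOb (FOb (V_functor enc) P) n) (FOb (FOb (V_functor enc) Q) n) (fn (fn ?h n)))"
      by (simp add: V_functor_def)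
    note lift = Q.equalizer_lift[unfolded S, OF h eq]
    show "FAr (V_functor enc) f \<in> Hom sSet_pointed (FOb (V_functor enc) P) (FOb (V_functor enc) Q)"
      using lift(1) by (simp only: V V_functor_ob)
    show "Cmp sSet_pointed (V_incl enc Q) (FAr (V_functor enc) f) = ?h"
      using lift(2) by (simp only: V V_functor_ob V_incl_eq)
  next
    fix X :: "'u spset" assume X: "X \<in> Ob sSet_pointed"
    let ?P = "(FOb (Z_tilde enc) X, FAr (Z_tilde enc) (eta enc X))"
    have P: "?P \<in> Ob (coAlg enc)"
      using comparison_Ob[OF X] by (simp only: E)
    interpret P: parallel_maps "FAr U_functor (snd ?P)" "eta enc (FOb U_functor (fst ?P))" "FOb U_functor (fst ?P)"
      "FOb U_functor (FOb (Z_tilde enc) (FOb U_functor (fst ?P)))" by (rule par[OF P])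
    have eta: "eta enc X \<in> Hom sSet_pointed X (FOb U_functor (fst ?P))"
      using unt_Hom[OF X] by simp
    \<comment> \<open>The unit equalizes the pair of the free coalgebra by its own naturality at
      \<open>eta enc X\<close>.\<close>
    have "Cmp sSet_pointed (FAr U_functor (snd ?P)) (eta enc X) =
        Cmp sSet_pointed (eta enc (FOb U_functor (fst ?P))) (eta enc X)"
      using unt_nat[OF unt_Hom[OF X]] by simp
    note lift = P.equalizer_lift[unfolded S, OF eta this]
    have u: "comparison_unit enc X = Arrow X (FOb (V_functor enc) ?P)
        (\<lambda>n. Arrow (FOb X n) (FOb (FOb (V_functor enc) ?P) n) (fn (fn (eta enc X) n)))"
      by (simp add: comparison_unit_def Can_def comparison_def Let_def)
    show "comparison_unit enc X \<in> Hom sSet_pointed X (FOb (V_functor enc) ?P)"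
      using lift(1) by (simp only: u V_functor_ob)
    show "Cmp sSet_pointed (V_incl enc ?P) (comparison_unit enc X) = eta enc X"
      using lift(2) by (simp only: u V_functor_ob V_incl_eq)
  qed
qed

text \<open>Composition, the comonad and its structure maps all act degreewise, so the coalgebra
  laws hold in each degree. This reduces both isomorphisms to statements about sets and
  groups.\<close>

lemma coAlg_level:
  fixes enc :: "('u \<Rightarrow>\<^sub>0 int) set \<Rightarrow> 'u"
  assumes P: "P \<in> Ob (coAlg enc)"
  shows "coalgebra ab_cat (level_comonad enc) (FOb (fst P) n) (fn (snd P) n)"
    and "src (snd P) = fst P"
proof -
  have A: "fst P \<in> Ob (simplicial ab_cat)"
    and d: "snd P \<in> Hom (simplicial ab_cat) (fst P) (levelwise_ob (reduced_free enc) (levelwise_ob forget (fst P)))"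
    and e1: "Cmp (simplicial ab_cat) (eps enc (fst P)) (snd P) = Ide (simplicial ab_cat) (fst P)"
    and e2: "Cmp (simplicial ab_cat) (FAr (levelwise (reduced_free enc)) (FAr (levelwise forget) (snd P))) (snd P) =
      Cmp (simplicial ab_cat) (FAr (levelwise (reduced_free enc)) (eta enc (levelwise_ob forget (fst P)))) (snd P)"
    using P by (auto simp: coAlg_def Ob_coalg_cat coalgebra_def K_comonad_def adjunction_comonad_def comp_functor_def
        sAb_def Z_tilde_def U_functor_def simp del: simplicial_sel levelwise_sel(2))
  show "src (snd P) = fst P" using d by (simp add: Hom_simplicial)
  show "coalgebra ab_cat (level_comonad enc) (FOb (fst P) n) (fn (snd P) n)"
    using simplicial_ob_level[OF A, of n] simplicial_map_level[OF d, of n]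
      arg_cong[OF e1, of "\<lambda>f. fn f n"] arg_cong[OF e2, of "\<lambda>f. fn f n"]
    by (simp add: coalgebra_def adjunction_comonad_def comp_functor_def eta_def eps_def levelwise_trans_def
        del: ab_cat_sel)
qed

lemma V_functor_level:
  fixes enc :: "('u \<Rightarrow>\<^sub>0 int) set \<Rightarrow> 'u"
  assumes P: "P \<in> Ob (coAlg enc)"
  shows "points (FOb (FOb (V_functor enc) P) n) = group_likes enc (FOb (fst P) n) (fn (snd P) n)"
    and "base (FOb (FOb (V_functor enc) P) n) = \<one>\<^bsub>FOb (fst P) n\<^esub>"
  using coAlg_level(2)[OF P]
  by (auto simp: V_functor_ob equalizer_def equalizer_level_def group_likes_def U_functor_def eta_def levelwise_trans_def)

theorem theorem2p1p12:
  fixes enc :: "('u \<Rightarrow>\<^sub>0 int) set \<Rightarrow> 'u"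
  assumes "coset_coding enc"
  shows "adjoint_equivalence sSet_pointed (coAlg enc) (Can enc) (V_functor enc)
           (comparison_unit enc) (comparison_counit enc)"
proof -
  note enc = assms
  interpret comparison_adjunction sSet_pointed sAb "Z_tilde enc" U_functor "eta enc" "eps enc"
      "V_functor enc" "V_incl enc" "comparison_unit enc"
    by (rule comparison_adjunction_coAlg[OF enc])
  have E: "coalg_cat sAb (adjunction_comonad (Z_tilde enc) U_functor (eta enc) (eps enc)) = coAlg enc"
    by (simp add: coAlg_def K_comonad_def)
  have Cn: "comparison sSet_pointed (Z_tilde enc) (eta enc) = Can enc"
    by (simp add: Can_def)
  have cc: "(\<lambda>P. Arrow (FOb (Can enc) (FOb (V_functor enc) P)) P
      (Cmp sAb (eps enc (fst P)) (FAr (Z_tilde enc) (V_incl enc P)))) = comparison_counit enc"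
    by (simp add: comparison_counit_def fun_eq_iff)
  have adj: "adjunction sSet_pointed (coAlg enc) (Can enc) (V_functor enc) (comparison_unit enc) (comparison_counit enc)"
    using comparison_is_adjunction by (simp only: E Cn cc)
  moreover have "isomorphism sSet_pointed (comparison_unit enc X)" if X: "X \<in> Ob sSet_pointed" for X
  proof -
    let ?P = "(FOb (Z_tilde enc) X, FAr (Z_tilde enc) (eta enc X))"
    have P: "?P \<in> Ob (coAlg enc)"
      using comparison_Ob[OF X] by (simp only: E)
    have u: "comparison_unit enc X \<in> Hom (simplicial pset_cat) X (FOb (V_functor enc) ?P)"
      using u_Hom[OF X] by (simp only: sSet_pointed_def)
    have "isomorphism pset_cat (fn (comparison_unit enc X) n)" for n
    proof (rule isomorphism_pset[OF simplicial_map_level[OF u]])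
      let ?S = "FOb X n" and ?h = "fn (fn (comparison_unit enc X) n)"
      have S: "base ?S \<in> points ?S" using simplicial_map_level[OF u, of n] by (simp add: Hom_pset)
      \<comment> \<open>Only the codomain of the unit was cut down; as a function it is still the
        Hurewicz map.\<close>
      have h: "?h = fn (hurewicz enc ?S)"
        by (simp add: comparison_unit_def eta_def levelwise_trans_def Let_def)
      have "points (FOb (FOb (V_functor enc) ?P) n) =
          group_likes enc (reduced_free_ob enc ?S) (FAr (reduced_free enc) (hurewicz enc ?S))"
        using V_functor_level(1)[OF P, of n] by (simp add: Z_tilde_def eta_def levelwise_trans_def)
      moreover have "group_likes enc (reduced_free_ob enc ?S) (FAr (reduced_free enc) (hurewicz enc ?S))
          \<subseteq> fn (hurewicz enc ?S) ` points ?S"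
        using hurewicz_image[OF enc S] by (auto simp: group_likes_def)
      \<comment> \<open>The reverse inclusion is free, since the unit is already known to be an
        arrow into the equalizer.\<close>
      moreover have "?h ` points ?S \<subseteq> points (FOb (FOb (V_functor enc) ?P) n)"
        using simplicial_map_level[OF u, of n] by (auto simp: Hom_pset)
      ultimately show "bij_betw ?h (points ?S) (points (FOb (FOb (V_functor enc) ?P) n))"
        using hurewicz_inj[OF enc, of ?S] unfolding bij_betw_def h by blast
    qed
    then show ?thesis
      unfolding sSet_pointed_def by (rule isomorphism_simplicial[OF category_pset_cat u])
  qed
  moreover have "isomorphism (coAlg enc) (comparison_counit enc P)" if P: "P \<in> Ob (coAlg enc)" for P
  proof -
    let ?V = "FOb (V_functor enc) P" and ?c = "fn (comparison_counit enc P)"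
    have c: "comparison_counit enc P \<in> Hom (coAlg enc) (FOb (Can enc) ?V) P"
      using counit_Hom[unfolded E Cn, OF P] by (simp only: comparison_counit_def)
    then have c': "?c \<in> Hom (simplicial ab_cat) (levelwise_ob (reduced_free enc) ?V) (fst P)"
      by (simp add: coAlg_def Hom_coalg_cat sAb_def Can_def comparison_def Z_tilde_def)
    have "isomorphism ab_cat (fn ?c n)" for n
    proof (rule isomorphism_ab[OF simplicial_map_level[OF c']])
      let ?A = "FOb (fst P) n" and ?d = "fn (snd P) n"
      note co = coAlg_level(1)[OF P, of n] and V = V_functor_level[OF P, of n]
      note A = coalgebra_levelD(1)[OF enc co]
      have i: "V_incl enc P \<in> Hom (simplicial pset_cat) ?V (levelwise_ob forget (fst P))"
        using incl[unfolded E, OF P] by (simp add: sSet_pointed_def U_functor_def)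
      note i' = simplicial_map_level[OF i, of n, simplified levelwise_ob_level forget_sel]
      have "fn (fn ?c n) (cls enc \<one>\<^bsub>?A\<^esub> c) = evaluate ?A c" if k: "Poly_Mapping.keys c \<subseteq> points (FOb ?V n)" for c
      proof -
        \<comment> \<open>The inclusion fixes every point of the support, so applying
          \<open>Z_tilde\<close> to it keeps the representative c, now read as a chain on the whole
          group; \<open>eps\<close> then evaluates it.\<close>
        have "fn (fn (V_incl enc P) n) x = x" if "x \<in> points (FOb ?V n)" for x
          using that by (auto simp: V_incl_eq V_functor_ob equalizer_incl_def equalizer_def)
        then have "push (fn (fn (V_incl enc P) n)) c = c" using k by (intro push_id) auto
        moreover have "Poly_Mapping.keys c \<subseteq> carrier ?A" using k V(1) by (auto simp: group_likes_def)
        moreover have "cls enc \<one>\<^bsub>?A\<^esub> c \<in> carrier (reduced_free_ob enc (FOb ?V n))"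
          using cls_in_carrier[OF k] V(2) by simp
        moreover have "src (fn (V_incl enc P) n) = FOb ?V n" using i' by (simp add: Hom_pset)
        ultimately show ?thesis
          using reduced_free_cls[OF enc i' k]
          by (simp add: comparison_counit_def sAb_def Z_tilde_def eps_def levelwise_trans_def compose_def
              V(2) linearize_cls[OF enc A])
      qed
      from bij_betw_evaluate_group_likes[OF enc co V this]
      show "bij_betw (fn (fn ?c n)) (carrier (FOb (levelwise_ob (reduced_free enc) ?V) n)) (carrier ?A)"
        by simp
    qed
    \<comment> \<open>The inverses of the degrees assemble to an inverse in \<open>sAb\<close>,
      which then lifts to coalgebras.\<close>
    then have "isomorphism sAb ?c"
      unfolding sAb_def by (rule isomorphism_simplicial[OF category_ab_cat c'])
    then show ?thesis
      using isomorphism_coalg_cat[OF K_functor, unfolded E, OF c] by simp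
  qed
  ultimately show ?thesis
    by (intro adjoint_equivalence.intro adjoint_equivalence_axioms.intro)
qed

end
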